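(* Let $T>0$ and $s>3/2$, and let $u\in C([0,T]:H^s(\mathbb{R}))$ be a strong solution of the initial value problem associated to the Camassa-Holm equation in integral-differential form $$\partial_t u+u\,\partial_x u+\partial_x G\ast\Big(u^2+\tfrac12(\partial_x u)^2\Big)=0,\qquad G(x)=\tfrac12 e^{-|x|},$$ with initial datum $u_0(x)=u(x,0)$. Suppose that for some $\alpha\in(1/2,1)$ $$|u_0(x)|= o(e^{-x})\quad\text{and}\quad |\partial_x u_0(x)|= O(e^{-\alpha x})\qquad\text{as } x\to+\infty,$$ and that there exists $t_1\in(0,T]$ such that $$|u(x,t_1)|= o(e^{-x})\qquad\text{as } x\to+\infty.$$ Then $u\equiv 0$ on $\mathbb{R}\times[0,T]$.
   Context: Functions are real-valued, $\ast$ denotes convolution in $x\in\mathbb{R}$, and $H^s(\mathbb{R})$ is the usual $L^2$-based Sobolev space. A strong solution on $[0,T]$ is a function $u\in C([0,T]:H^s(\mathbb{R}))\cap C^1([0,T]:H^{s-1}(\mathbb{R}))$ satisfying the equation for every $t\in[0,T]$ as an identity in $H^{s-1}(\mathbb{R})$. Since $s>3/2$, $u(\cdot,t)$ and $\partial_x u(\cdot,t)$ are continuous bounded functions, so pointwise statements make sense. The equation is the integral-differential form of the Camassa-Holm equation $\partial_t u-\partial_t\partial_x^2u+3u\partial_xu-2\partial_xu\,\partial_x^2u-u\,\partial_x^3u=0$, obtained by inverting $1-\partial_x^2$, whose fundamental solution is $\tfrac12e^{-|x|}$. *)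

theory Defs
  imports "HOL-Analysis.Analysis" "HOL-Library.Landau_Symbols"
begin

definition square_integrable :: "(real \<Rightarrow> 'a::euclidean_space) \<Rightarrow> bool" where
  "square_integrable f \<longleftrightarrow>
     f \<in> borel_measurable lborel \<and> integrable lborel (\<lambda>x. (norm (f x))\<^sup>2)"

definition truncated_fourier :: "real \<Rightarrow> (real \<Rightarrow> real) \<Rightarrow> real \<Rightarrow> complex" where
  "truncated_fourier R f \<xi> =
     (1 / sqrt (2 * pi)) *\<^sub>R
       (LINT x:{-R..R}|lborel. complex_of_real (f x) * cis (- (x * \<xi>)))"

text \<open>The Fourier--Plancherel transform of an \<open>L\<^sup>2\<close> function is the \<open>L\<^sup>2\<close> limit of the transforms
  of its truncations; it is determined up to null sets, hence a relation. The error is measured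
  by a nonnegative integral so that a non-integrable error counts as infinite, not as zero.\<close>

definition is_fourier_transform :: "(real \<Rightarrow> real) \<Rightarrow> (real \<Rightarrow> complex) \<Rightarrow> bool" where
  "is_fourier_transform f g \<longleftrightarrow>
     square_integrable f \<and> square_integrable g \<and>
     ((\<lambda>R. \<integral>\<^sup>+ \<xi>. ennreal ((cmod (truncated_fourier R f \<xi> - g \<xi>))\<^sup>2) \<partial>lborel)
        \<longlongrightarrow> 0) at_top"

text \<open>The space \<open>H\<^sup>s\<close>, as a set of functions rather than of classes modulo null sets. Since its
  elements are required to be in \<open>L\<^sup>2\<close>, this is the usual space only for \<open>s \<ge> 0\<close>.\<close>

definition sobolev :: "real \<Rightarrow> (real \<Rightarrow> real) set" where
  "sobolev s = {f. \<exists>g. is_fourier_transform f g \<and>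
                     integrable lborel (\<lambda>\<xi>. (1 + \<xi>\<^sup>2) powr s * (cmod (g \<xi>))\<^sup>2)}"

text \<open>The choice of \<open>g\<close> is immaterial, as any two candidates agree almost everywhere. The value
  is meaningful only for \<open>f \<in> sobolev s\<close>.\<close>

definition sobolev_norm :: "real \<Rightarrow> (real \<Rightarrow> real) \<Rightarrow> real" where
  "sobolev_norm s f =
     (let g = (SOME g. is_fourier_transform f g)
      in sqrt (LINT \<xi>|lborel. (1 + \<xi>\<^sup>2) powr s * (cmod (g \<xi>))\<^sup>2))"

text \<open>Curves in a function space are written \<open>u t x\<close>, with time as the first argument. The next
  two definitions are \<open>u \<in> C([0,T] : H\<^sup>s)\<close> and: \<open>v\<close> is the derivative of \<open>u\<close> on \<open>[0,T]\<close> in the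
  norm of \<open>H\<^sup>s\<close> (one-sided at the endpoints).\<close>

definition sobolev_continuous :: "real \<Rightarrow> real \<Rightarrow> (real \<Rightarrow> real \<Rightarrow> real) \<Rightarrow> bool" where
  "sobolev_continuous s T u \<longleftrightarrow>
     (\<forall>t\<in>{0..T}. u t \<in> sobolev s \<and>
        ((\<lambda>\<tau>. sobolev_norm s (\<lambda>x. u \<tau> x - u t x)) \<longlongrightarrow> 0) (at t within {0..T}))"

definition sobolev_time_derivative ::
    "real \<Rightarrow> real \<Rightarrow> (real \<Rightarrow> real \<Rightarrow> real) \<Rightarrow> (real \<Rightarrow> real \<Rightarrow> real) \<Rightarrow> bool" where
  "sobolev_time_derivative s T u v \<longleftrightarrow>
     (\<forall>t\<in>{0..T}. u t \<in> sobolev s \<and> v t \<in> sobolev s \<and>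
        ((\<lambda>\<tau>. sobolev_norm s (\<lambda>x. (u \<tau> x - u t x) / (\<tau> - t) - v t x)) \<longlongrightarrow> 0)
          (at t within {0..T}))"

definition convolution :: "(real \<Rightarrow> real) \<Rightarrow> (real \<Rightarrow> real) \<Rightarrow> real \<Rightarrow> real" where
  "convolution f g x = (LINT y|lborel. f (x - y) * g y)"

definition G :: "real \<Rightarrow> real" where
  "G x = exp (- \<bar>x\<bar>) / 2"

text \<open>\<open>G\<close> is Lipschitz, so its distributional derivative is the pointwise one, which exists except
  at \<open>0\<close>; the unspecified value of \<open>deriv G 0\<close> does not affect the convolution. Functions in
  \<open>H\<^sup>s\<close> with \<open>s > 3/2\<close> have a \<open>C\<^sup>1\<close> representative, so for \<open>u t\<close> the continuous representative,
  \<open>deriv (u t)\<close> is its weak derivative. An identity in \<open>H\<^sup>s\<^sup>-\<^sup>1\<close> is one of functions modulo null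
  sets.\<close>

definition CH_strong_solution :: "real \<Rightarrow> real \<Rightarrow> (real \<Rightarrow> real \<Rightarrow> real) \<Rightarrow> bool" where
  "CH_strong_solution s T u \<longleftrightarrow>
     (\<forall>t\<in>{0..T}. continuous_on UNIV (u t)) \<and>
     sobolev_continuous s T u \<and>
     (\<exists>v. sobolev_continuous (s - 1) T v \<and>
          sobolev_time_derivative (s - 1) T u v \<and>
          (\<forall>t\<in>{0..T}. AE x in lborel.
             v t x + u t x * deriv (u t) x
               + convolution (deriv G) (\<lambda>y. (u t y)\<^sup>2 + 1/2 * (deriv (u t) y)\<^sup>2) x = 0))"

end

theory Submission
  imports Defs "HOL-Probability.Characteristic_Functions"
begin

text \<open>
  Write \<open>F = u\<^sup>2 + u\<^sub>x\<^sup>2/2\<close>. Splitting the kernel of \<open>\<partial>\<^sub>x G\<close> at the origin, the equation becomes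
  \<open>u\<^sub>t = - u u\<^sub>x + (l - r)/2\<close> with the two tails
  \<open>l(x) = e\<^sup>-\<^sup>x \<integral>\<^bsub>y<x\<^esub> e\<^sup>y F(y) dy\<close> and \<open>r(x) = e\<^sup>x \<integral>\<^bsub>y>x\<^esub> e\<^sup>-\<^sup>y F(y) dy\<close>.
  Suppose the decay \<open>u, u\<^sub>x = O(e\<^sup>-\<^sup>\<alpha>\<^sup>x)\<close>, which holds initially, persists on the whole time interval.
  Then \<open>u u\<^sub>x\<close> and \<open>r\<close> are of the order \<open>e\<^sup>-\<^sup>2\<^sup>\<alpha>\<^sup>x\<close>, which is \<open>o(e\<^sup>-\<^sup>x)\<close> as \<open>\<alpha> > 1/2\<close>, whereas
  \<open>e\<^sup>x l(x)\<close> is nonnegative and nondecreasing in \<open>x\<close>. So \<open>e\<^sup>x (u(x,t\<^sub>1) - u(x,0))\<close> stays above a positive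
  constant for large \<open>x\<close> unless \<open>F\<close> vanishes at time \<open>0\<close>. Since that difference is \<open>o(e\<^sup>-\<^sup>x)\<close>, the initial
  datum is zero, and uniqueness gives \<open>u = 0\<close>. This is \<open>decay_at_two_times_implies_zero\<close>.

  Persistence (\<open>persistence_of_decay\<close>) bounds \<open>u\<close> and \<open>u\<^sub>x\<close> by a multiple of the size of the initial
  datum in the weight, so it contains the uniqueness statement as the case of a zero datum. The function \<open>u\<close>
  itself is controlled by integrating the equation in time. For \<open>u\<^sub>x\<close>, which in general has no
  pointwise time derivative, the increment \<open>u(x + h) - u(x)\<close> is compared with a barrier: where it first
  touches the barrier its \<open>x\<close>-derivative is known, and this turns the transport term into a term
  of order zero (\<open>negative_by_first_contact\<close>). Letting \<open>h\<close> tend to \<open>0\<close> bounds \<open>u\<^sub>x\<close>. The weight is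
  \<open>e\<^sup>-\<^sup>\<alpha>\<^sup>x + \<epsilon> e\<^sup>\<alpha>\<^sup>x\<close>; it grows at both ends, so that the barrier cannot be reached near
  infinity, and \<open>\<epsilon>\<close> tends to \<open>0\<close> at the end.

  These arguments use only sup-norm information: \<open>u\<close> and \<open>u\<^sub>x\<close> are bounded, depend continuously on
  time in the sup norm, and \<open>u\<close> has the pointwise time derivative that the equation prescribes. All this
  follows from the embedding of \<open>H\<^sup>r\<close> into the bounded continuous functions for \<open>r > 1/2\<close>, applied
  to \<open>u\<close>, \<open>u\<^sub>x\<close> and the difference quotients of \<open>u\<close> in time (\<open>strong_solution_is_classical\<close>). The
  embedding in turn rests on Fourier inversion for functions with an integrable transform
  (\<open>fourier_inversion\<close>).
\<close>

section \<open>Square-integrable functions and the Fourier--Plancherel transform\<close>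

lemma integrable_gaussian:
  fixes \<sigma> :: real
  assumes "\<sigma> \<noteq> 0"
  shows "integrable lborel (\<lambda>x. exp (- (\<sigma> * x)\<^sup>2 / 2))"
proof -
  have "integrable lborel (\<lambda>x. sqrt (2 * pi) * std_normal_density (0 + \<sigma> * x))"
    by (intro integrable_mult_right lborel_integrable_real_affine) (use assms in auto)
  then show ?thesis by (simp add: std_normal_density_def)
qed

text \<open>This is the characteristic function of the standard normal distribution, rescaled.\<close>
lemma fourier_gaussian:
  fixes z \<sigma> :: real
  assumes "\<sigma> > 0"
  shows "(LINT \<xi>|lborel. cis (z * \<xi>) * complex_of_real (exp (- (\<sigma> * \<xi>)\<^sup>2 / 2)))
    = complex_of_real (sqrt (2 * pi) / \<sigma> * exp (- (z / \<sigma>)\<^sup>2 / 2))"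
proof -
  define h where "h \<eta> = cis (z * \<eta> / \<sigma>) * complex_of_real (exp (- \<eta>\<^sup>2 / 2))" for \<eta>
  have "complex_of_real (exp (- (z / \<sigma>)\<^sup>2 / 2)) = (LINT \<eta>|lborel. std_normal_density \<eta> *\<^sub>R iexp (z / \<sigma> * \<eta>))"
    using fun_cong[OF char_std_normal_distribution, of "z / \<sigma>"]
    by (simp add: char_def integral_density)
  also have "\<dots> = (LINT \<eta>|lborel. (1 / sqrt (2 * pi)) *\<^sub>R h \<eta>)"
    by (intro Bochner_Integration.integral_cong)
       (auto simp: h_def std_normal_density_def cis_conv_exp scaleR_conv_of_real mult_ac)
  finally have 1: "complex_of_real (exp (- (z / \<sigma>)\<^sup>2 / 2)) = (1 / sqrt (2 * pi)) *\<^sub>R (LINT \<eta>|lborel. h \<eta>)"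
    by simp
  have "(LINT \<eta>|lborel. h \<eta>) = \<bar>\<sigma>\<bar> *\<^sub>R (LINT \<xi>|lborel. h (0 + \<sigma> * \<xi>))"
    using assms by (intro lborel_integral_real_affine) auto
  then have "(LINT \<xi>|lborel. h (\<sigma> * \<xi>)) = (sqrt (2 * pi) / \<sigma>) *\<^sub>R ((1 / sqrt (2 * pi)) *\<^sub>R (LINT \<eta>|lborel. h \<eta>))"
    using assms by simp
  then show ?thesis
    using assms unfolding 1[symmetric] by (simp add: h_def scaleR_conv_of_real)
qed

lemma integrable_mult_of_square_integrable:
  fixes f g :: "real \<Rightarrow> complex"
  assumes f: "square_integrable f" and g: "square_integrable g"
  shows "integrable lborel (\<lambda>x. f x * g x)"
proof (rule Bochner_Integration.integrable_bound)
  show "integrable lborel (\<lambda>x. (norm (f x))\<^sup>2 + (norm (g x))\<^sup>2)"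
    using f g by (simp add: square_integrable_def)
  have [measurable]: "f \<in> borel_measurable borel" "g \<in> borel_measurable borel"
    using f g by (auto simp: square_integrable_def)
  show "(\<lambda>x. f x * g x) \<in> borel_measurable lborel" by measurable
  have "a * b \<le> a\<^sup>2 + b\<^sup>2" if "a \<ge> 0" "b \<ge> 0" for a b :: real
    using that sum_squares_bound[of a b] mult_nonneg_nonneg[OF that] by linarith
  then show "AE x in lborel. norm (f x * g x) \<le> norm ((norm (f x))\<^sup>2 + (norm (g x))\<^sup>2)"
    by (simp add: norm_mult)
qed

lemma square_integrable_add:
  fixes f g :: "real \<Rightarrow> 'a::euclidean_space"
  assumes f: "square_integrable f" and g: "square_integrable g"
  shows "square_integrable (\<lambda>x. f x + g x)"
proof -
  have [measurable]: "f \<in> borel_measurable borel" "g \<in> borel_measurable borel"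
    using f g by (auto simp: square_integrable_def)
  have "integrable lborel (\<lambda>x. (norm (f x + g x))\<^sup>2)"
  proof (rule Bochner_Integration.integrable_bound)
    show "integrable lborel (\<lambda>x. 2 * (norm (f x))\<^sup>2 + 2 * (norm (g x))\<^sup>2)"
      using f g by (simp add: square_integrable_def)
    have "(norm (f x + g x))\<^sup>2 \<le> 2 * (norm (f x))\<^sup>2 + 2 * (norm (g x))\<^sup>2" for x
    proof -
      have "(norm (f x + g x))\<^sup>2 \<le> (norm (f x) + norm (g x))\<^sup>2"
        by (intro power_mono norm_triangle_ineq) auto
      also have "\<dots> \<le> 2 * (norm (f x))\<^sup>2 + 2 * (norm (g x))\<^sup>2"
        using sum_squares_bound[of "norm (f x)" "norm (g x)"] by (simp add: power2_sum)
      finally show ?thesis .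
    qed
    then show "AE x in lborel. norm ((norm (f x + g x))\<^sup>2) \<le> norm (2 * (norm (f x))\<^sup>2 + 2 * (norm (g x))\<^sup>2)"
      by simp
  qed measurable
  then show ?thesis by (simp add: square_integrable_def)
qed

lemma square_integrable_scaleR:
  fixes f :: "real \<Rightarrow> 'a::euclidean_space"
  assumes "square_integrable f"
  shows "square_integrable (\<lambda>x. c *\<^sub>R f x)"
  using assms by (auto simp: square_integrable_def power_mult_distrib)

lemma set_integrable_square_integrable:
  fixes f :: "real \<Rightarrow> real"
  assumes "square_integrable f"
  shows "integrable lborel (\<lambda>y. indicator {-R..R} y * f y)"
proof (rule Bochner_Integration.integrable_bound)
  have [measurable]: "f \<in> borel_measurable borel"
    using assms by (auto simp: square_integrable_def)
  show "integrable lborel (\<lambda>y. indicator {-R..R} y + (f y)\<^sup>2)"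
    using assms by (intro Bochner_Integration.integrable_add integrable_real_indicator)
      (auto simp: square_integrable_def emeasure_lborel_Icc_eq)
  show "(\<lambda>y. indicator {-R..R} y * f y) \<in> borel_measurable lborel" by measurable
  have "\<bar>a\<bar> \<le> 1 + a\<^sup>2" for a :: real
    using sum_squares_bound[of "\<bar>a\<bar>" 1] zero_le_power2[of a] by (simp del: zero_le_power2)
  then show "AE y in lborel. norm (indicator {-R..R} y * f y) \<le> norm (indicator {-R..R} y + (f y)\<^sup>2)"
    by (auto simp: indicator_def)
qed

lemma truncated_fourier_eq:
  "truncated_fourier R f \<xi> =
    (1 / sqrt (2 * pi)) *\<^sub>R (LINT y|lborel. complex_of_real (indicator {-R..R} y * f y) * cis (- (y * \<xi>)))"
  unfolding truncated_fourier_def set_lebesgue_integral_def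
  by (intro arg_cong2[where f = scaleR] refl Bochner_Integration.integral_cong) (auto simp: indicator_def)

lemma borel_measurable_truncated_fourier:
  assumes "f \<in> borel_measurable borel"
  shows "truncated_fourier R f \<in> borel_measurable borel"
proof -
  note [measurable] = assms
  have [measurable]: "cis \<in> borel_measurable borel"
    by (intro borel_measurable_continuous_onI continuous_intros)
  have "(\<lambda>\<xi>. (1 / sqrt (2 * pi)) *\<^sub>R (LINT y|lborel. complex_of_real (indicator {-R..R} y * f y) * cis (- (y * \<xi>)))) \<in> borel_measurable lborel"
    by measurable
  then show ?thesis by (simp add: truncated_fourier_eq[abs_def])
qed

lemma truncated_fourier_AE_cong:
  assumes "f \<in> borel_measurable borel" "h \<in> borel_measurable borel" "AE x in lborel. f x = h x"
  shows "truncated_fourier R f \<xi> = truncated_fourier R h \<xi>"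
proof -
  note [measurable] = assms(1,2)
  have [measurable]: "cis \<in> borel_measurable borel"
    by (intro borel_measurable_continuous_onI continuous_intros)
  have "(LINT y|lborel. complex_of_real (indicator {-R..R} y * f y) * cis (- (y * \<xi>)))
      = (LINT y|lborel. complex_of_real (indicator {-R..R} y * h y) * cis (- (y * \<xi>)))"
    by (intro integral_cong_AE) (use assms(3) in auto)
  then show ?thesis by (simp add: truncated_fourier_eq)
qed

text \<open>Truncated transforms are integrals and do not see null sets. This lets the time derivative, known
  only up to null sets, be replaced by a continuous representative.\<close>
lemma is_fourier_transform_AE_cong:
  assumes "is_fourier_transform f g" "h \<in> borel_measurable borel" "AE x in lborel. f x = h x"
  shows "is_fourier_transform h g"
proof -
  have f: "square_integrable f" using assms by (simp add: is_fourier_transform_def)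
  then have [measurable]: "f \<in> borel_measurable borel" by (simp add: square_integrable_def)
  note [measurable] = assms(2)
  have "integrable lborel (\<lambda>x. (norm (f x))\<^sup>2) \<longleftrightarrow> integrable lborel (\<lambda>x. (norm (h x))\<^sup>2)"
    by (intro integrable_cong_AE) (use assms(3) in auto)
  then have "square_integrable h" using f by (simp add: square_integrable_def)
  moreover have "truncated_fourier R f = truncated_fourier R h" for R
    using truncated_fourier_AE_cong[OF _ assms(2,3)] by auto
  ultimately show ?thesis using assms(1) by (simp add: is_fourier_transform_def)
qed

lemma ennreal_norm_add_square_le:
  fixes a b :: "'a::real_normed_vector"
  shows "ennreal ((norm (a + b))\<^sup>2) \<le> 2 * ennreal ((norm a)\<^sup>2) + 2 * ennreal ((norm b)\<^sup>2)"
proof -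
  have "(norm (a + b))\<^sup>2 \<le> (norm a + norm b)\<^sup>2"
    by (intro power_mono norm_triangle_ineq) auto
  also have "\<dots> \<le> 2 * (norm a)\<^sup>2 + 2 * (norm b)\<^sup>2"
    using sum_squares_bound[of "norm a" "norm b"] by (simp add: power2_sum)
  finally have "ennreal ((norm (a + b))\<^sup>2) \<le> ennreal (2 * (norm a)\<^sup>2 + 2 * (norm b)\<^sup>2)"
    by (rule ennreal_leI)
  then show ?thesis by (simp add: ennreal_mult'')
qed

text \<open>Two \<open>L\<^sup>2\<close> limits of the same family agree. This makes \<open>sobolev_norm\<close>, which takes an arbitrary
  transform, independent of that choice.\<close>
lemma is_fourier_transform_unique:
  assumes g: "is_fourier_transform f g" and h: "is_fourier_transform f h"
  shows "AE \<xi> in lborel. g \<xi> = h \<xi>"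
proof -
  let ?N = "\<lambda>a b. \<integral>\<^sup>+ \<xi>. ennreal ((cmod (a \<xi> - b \<xi>))\<^sup>2) \<partial>lborel"
  have [measurable]: "f \<in> borel_measurable borel" "g \<in> borel_measurable borel" "h \<in> borel_measurable borel"
    using g h by (auto simp: is_fourier_transform_def square_integrable_def)
  note [measurable] = borel_measurable_truncated_fourier
  have le: "?N g h \<le> 2 * ?N (truncated_fourier R f) g + 2 * ?N (truncated_fourier R f) h" for R
  proof -
    have "?N g h \<le> (\<integral>\<^sup>+ \<xi>. (2 * ennreal ((cmod (truncated_fourier R f \<xi> - g \<xi>))\<^sup>2) +
        2 * ennreal ((cmod (truncated_fourier R f \<xi> - h \<xi>))\<^sup>2)) \<partial>lborel)"
    proof (intro nn_integral_mono)
      fix \<xi>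
      show "ennreal ((cmod (g \<xi> - h \<xi>))\<^sup>2) \<le> 2 * ennreal ((cmod (truncated_fourier R f \<xi> - g \<xi>))\<^sup>2) +
        2 * ennreal ((cmod (truncated_fourier R f \<xi> - h \<xi>))\<^sup>2)"
        using ennreal_norm_add_square_le[of "g \<xi> - truncated_fourier R f \<xi>" "truncated_fourier R f \<xi> - h \<xi>"]
        by (simp add: norm_minus_commute)
    qed
    also have "\<dots> = 2 * ?N (truncated_fourier R f) g + 2 * ?N (truncated_fourier R f) h"
      by (subst nn_integral_add) (auto simp: nn_integral_cmult)
    finally show ?thesis .
  qed
  have "((\<lambda>R. 2 * ?N (truncated_fourier R f) g + 2 * ?N (truncated_fourier R f) h) \<longlongrightarrow> 2 * 0 + 2 * 0) at_top"
    using g h unfolding is_fourier_transform_def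
    by (intro tendsto_add ennreal_tendsto_cmult) auto
  then have "?N g h \<le> 2 * 0 + 2 * 0"
    by (rule tendsto_lowerbound) (use le in \<open>auto intro: always_eventually\<close>)
  then have "AE \<xi> in lborel. ennreal ((cmod (g \<xi> - h \<xi>))\<^sup>2) = 0"
    by (subst nn_integral_0_iff_AE[symmetric]) auto
  then show ?thesis by (auto simp: ennreal_eq_0_iff)
qed

lemma truncated_fourier_lincomb:
  assumes f: "square_integrable f" and h: "square_integrable h"
  shows "truncated_fourier R (\<lambda>x. f x + c * h x) \<xi> = truncated_fourier R f \<xi> + c *\<^sub>R truncated_fourier R h \<xi>"
proof -
  have [measurable]: "f \<in> borel_measurable borel" "h \<in> borel_measurable borel"
    using f h by (auto simp: square_integrable_def)
  have [measurable]: "cis \<in> borel_measurable borel"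
    by (intro borel_measurable_continuous_onI continuous_intros)
  have int: "integrable lborel (\<lambda>y. complex_of_real (indicator {-R..R} y * k y) * cis (- (y * \<xi>)))"
    if "square_integrable k" and [measurable]: "k \<in> borel_measurable borel" for k
    by (rule Bochner_Integration.integrable_bound[OF set_integrable_square_integrable[OF that(1), of R]])
       (auto simp: norm_mult)
  have "(LINT y|lborel. complex_of_real (indicator {-R..R} y * (f y + c * h y)) * cis (- (y * \<xi>)))
     = (LINT y|lborel. complex_of_real (indicator {-R..R} y * f y) * cis (- (y * \<xi>))
        + c *\<^sub>R (complex_of_real (indicator {-R..R} y * h y) * cis (- (y * \<xi>))))"
    by (intro Bochner_Integration.integral_cong) (auto simp: algebra_simps scaleR_conv_of_real)
  also have "\<dots> = (LINT y|lborel. complex_of_real (indicator {-R..R} y * f y) * cis (- (y * \<xi>)))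
        + c *\<^sub>R (LINT y|lborel. (complex_of_real (indicator {-R..R} y * h y) * cis (- (y * \<xi>))))"
    by (subst Bochner_Integration.integral_add)
       (use int[OF f] int[OF h] in simp_all)
  finally show ?thesis by (simp add: truncated_fourier_eq scaleR_add_right)
qed

lemma is_fourier_transform_lincomb:
  assumes fg: "is_fourier_transform f g" and hk: "is_fourier_transform h k"
  shows "is_fourier_transform (\<lambda>x. f x + c * h x) (\<lambda>\<xi>. g \<xi> + c *\<^sub>R k \<xi>)"
proof -
  let ?N = "\<lambda>a b. \<integral>\<^sup>+ \<xi>. ennreal ((cmod (a \<xi> - b \<xi>))\<^sup>2) \<partial>lborel"
  let ?F = truncated_fourier
  have sq: "square_integrable f" "square_integrable g" "square_integrable h" "square_integrable k"
    using fg hk by (auto simp: is_fourier_transform_def)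
  then have [measurable]: "f \<in> borel_measurable borel" "h \<in> borel_measurable borel"
     "g \<in> borel_measurable borel" "k \<in> borel_measurable borel"
    by (auto simp: square_integrable_def)
  note [measurable] = borel_measurable_truncated_fourier
  have le: "?N (?F R (\<lambda>x. f x + c * h x)) (\<lambda>\<xi>. g \<xi> + c *\<^sub>R k \<xi>)
      \<le> 2 * ?N (?F R f) g + ennreal (2 * c\<^sup>2) * ?N (?F R h) k" for R
  proof -
    have "?N (?F R (\<lambda>x. f x + c * h x)) (\<lambda>\<xi>. g \<xi> + c *\<^sub>R k \<xi>)
      \<le> (\<integral>\<^sup>+ \<xi>. (2 * ennreal ((cmod (?F R f \<xi> - g \<xi>))\<^sup>2) +
        ennreal (2 * c\<^sup>2) * ennreal ((cmod (?F R h \<xi> - k \<xi>))\<^sup>2)) \<partial>lborel)"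
    proof (intro nn_integral_mono)
      fix \<xi>
      have "ennreal ((cmod (?F R (\<lambda>x. f x + c * h x) \<xi> - (g \<xi> + c *\<^sub>R k \<xi>)))\<^sup>2)
         = ennreal ((cmod ((?F R f \<xi> - g \<xi>) + c *\<^sub>R (?F R h \<xi> - k \<xi>)))\<^sup>2)"
        using sq by (simp add: truncated_fourier_lincomb algebra_simps)
      also have "\<dots> \<le> 2 * ennreal ((cmod (?F R f \<xi> - g \<xi>))\<^sup>2) + 2 * ennreal ((cmod (c *\<^sub>R (?F R h \<xi> - k \<xi>)))\<^sup>2)"
        by (rule ennreal_norm_add_square_le)
      also have "2 * ennreal ((cmod (c *\<^sub>R (?F R h \<xi> - k \<xi>)))\<^sup>2) = ennreal (2 * c\<^sup>2) * ennreal ((cmod (?F R h \<xi> - k \<xi>))\<^sup>2)"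
        by (simp add: power_mult_distrib ennreal_mult' ennreal_mult'' mult.assoc)
      finally show "ennreal ((cmod (?F R (\<lambda>x. f x + c * h x) \<xi> - (g \<xi> + c *\<^sub>R k \<xi>)))\<^sup>2)
        \<le> 2 * ennreal ((cmod (?F R f \<xi> - g \<xi>))\<^sup>2) + ennreal (2 * c\<^sup>2) * ennreal ((cmod (?F R h \<xi> - k \<xi>))\<^sup>2)" .
    qed
    also have "\<dots> = 2 * ?N (?F R f) g + ennreal (2 * c\<^sup>2) * ?N (?F R h) k"
      by (subst nn_integral_add) (auto simp: nn_integral_cmult)
    finally show ?thesis .
  qed
  have "((\<lambda>R. 2 * ?N (?F R f) g + ennreal (2 * c\<^sup>2) * ?N (?F R h) k) \<longlongrightarrow> 2 * 0 + ennreal (2 * c\<^sup>2) * 0) at_top"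
    (is "(?B \<longlongrightarrow> _) _") using fg hk unfolding is_fourier_transform_def
    by (intro tendsto_add ennreal_tendsto_cmult) auto
  then have lim: "(?B \<longlongrightarrow> 0) at_top" by simp
  have "((\<lambda>R. ?N (?F R (\<lambda>x. f x + c * h x)) (\<lambda>\<xi>. g \<xi> + c *\<^sub>R k \<xi>)) \<longlongrightarrow> 0) at_top"
    by (rule tendsto_sandwich[OF _ _ tendsto_const lim]; intro always_eventually allI zero_le le)
  moreover have "square_integrable (\<lambda>x. f x + c * h x)" "square_integrable (\<lambda>\<xi>. g \<xi> + c *\<^sub>R k \<xi>)"
    using square_integrable_add[OF sq(1) square_integrable_scaleR[OF sq(3)]]
      square_integrable_add[OF sq(2) square_integrable_scaleR[OF sq(4)]] by auto
  ultimately show ?thesis by (simp add: is_fourier_transform_def)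
qed

lemma sobolev_lincomb:
  assumes f: "f \<in> sobolev r" and h: "h \<in> sobolev r"
  shows "(\<lambda>x. f x + c * h x) \<in> sobolev r"
proof -
  obtain g where g: "is_fourier_transform f g" "integrable lborel (\<lambda>\<xi>. (1 + \<xi>\<^sup>2) powr r * (cmod (g \<xi>))\<^sup>2)"
    using f by (auto simp: sobolev_def)
  obtain k where k: "is_fourier_transform h k" "integrable lborel (\<lambda>\<xi>. (1 + \<xi>\<^sup>2) powr r * (cmod (k \<xi>))\<^sup>2)"
    using h by (auto simp: sobolev_def)
  have [measurable]: "g \<in> borel_measurable borel" "k \<in> borel_measurable borel"
    using g k by (auto simp: is_fourier_transform_def square_integrable_def)
  have "integrable lborel (\<lambda>\<xi>. (1 + \<xi>\<^sup>2) powr r * (cmod (g \<xi> + c *\<^sub>R k \<xi>))\<^sup>2)"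
  proof (rule Bochner_Integration.integrable_bound)
    show "integrable lborel (\<lambda>\<xi>. 2 * ((1 + \<xi>\<^sup>2) powr r * (cmod (g \<xi>))\<^sup>2) + 2 * c\<^sup>2 * ((1 + \<xi>\<^sup>2) powr r * (cmod (k \<xi>))\<^sup>2))"
      using g(2) k(2) by auto
    show "AE \<xi> in lborel. norm ((1 + \<xi>\<^sup>2) powr r * (cmod (g \<xi> + c *\<^sub>R k \<xi>))\<^sup>2)
      \<le> norm (2 * ((1 + \<xi>\<^sup>2) powr r * (cmod (g \<xi>))\<^sup>2) + 2 * c\<^sup>2 * ((1 + \<xi>\<^sup>2) powr r * (cmod (k \<xi>))\<^sup>2))"
    proof (intro AE_I2)
      fix \<xi> :: real
      have "(cmod (g \<xi> + c *\<^sub>R k \<xi>))\<^sup>2 \<le> (cmod (g \<xi>) + \<bar>c\<bar> * cmod (k \<xi>))\<^sup>2"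
        by (intro power_mono norm_triangle_le) auto
      also have "\<dots> \<le> 2 * (cmod (g \<xi>))\<^sup>2 + 2 * c\<^sup>2 * (cmod (k \<xi>))\<^sup>2"
        using sum_squares_bound[of "cmod (g \<xi>)" "\<bar>c\<bar> * cmod (k \<xi>)"] by (simp add: power2_sum power_mult_distrib)
      finally have "(1 + \<xi>\<^sup>2) powr r * (cmod (g \<xi> + c *\<^sub>R k \<xi>))\<^sup>2
          \<le> (1 + \<xi>\<^sup>2) powr r * (2 * (cmod (g \<xi>))\<^sup>2 + 2 * c\<^sup>2 * (cmod (k \<xi>))\<^sup>2)"
        by (intro mult_left_mono) auto
      then show "norm ((1 + \<xi>\<^sup>2) powr r * (cmod (g \<xi> + c *\<^sub>R k \<xi>))\<^sup>2)
      \<le> norm (2 * ((1 + \<xi>\<^sup>2) powr r * (cmod (g \<xi>))\<^sup>2) + 2 * c\<^sup>2 * ((1 + \<xi>\<^sup>2) powr r * (cmod (k \<xi>))\<^sup>2))"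
        by (simp add: algebra_simps)
    qed
  qed measurable
  then show ?thesis
    using is_fourier_transform_lincomb[OF g(1) k(1), of c] unfolding sobolev_def by auto
qed

section \<open>Fourier inversion\<close>

text \<open>The \<open>L\<^sup>2\<close> convergence of the truncated transforms is used only through this weak form, a consequence of
  the Cauchy--Schwarz inequality.\<close>
lemma fourier_pairing_limit:
  assumes fg: "is_fourier_transform f g" and \<psi>: "square_integrable \<psi>"
  shows "((\<lambda>R. LINT \<xi>|lborel. truncated_fourier R f \<xi> * \<psi> \<xi>) \<longlongrightarrow> (LINT \<xi>|lborel. g \<xi> * \<psi> \<xi>)) at_top"
proof -
  let ?F = truncated_fourier
  define N where "N R = (\<integral>\<^sup>+ \<xi>. ennreal ((cmod (?F R f \<xi> - g \<xi>))\<^sup>2) \<partial>lborel)" for R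
  define C where "C = (\<integral>\<^sup>+ \<xi>. ennreal ((cmod (\<psi> \<xi>))\<^sup>2) \<partial>lborel)"
  have g: "square_integrable g" and "square_integrable f"
    using fg by (auto simp: is_fourier_transform_def)
  then have [measurable]: "f \<in> borel_measurable borel" "g \<in> borel_measurable borel" "\<psi> \<in> borel_measurable borel"
    using \<psi> by (auto simp: square_integrable_def)
  note [measurable] = borel_measurable_truncated_fourier
  have N0: "(N \<longlongrightarrow> 0) at_top" using fg by (simp add: is_fourier_transform_def N_def[abs_def])
  have C: "C < \<infinity>"
    using \<psi> unfolding C_def square_integrable_def integrable_iff_bounded by simp
  have bound: "(norm ((LINT \<xi>|lborel. ?F R f \<xi> * \<psi> \<xi>) - (LINT \<xi>|lborel. g \<xi> * \<psi> \<xi>)))\<^sup>2 \<le> enn2real (N R) * enn2real C"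
    if "N R < 1" for R
  proof -
    have NR: "N R < \<infinity>" using that by (simp add: less_trans[OF _ ennreal_one_less_top])
    have "square_integrable (\<lambda>\<xi>. ?F R f \<xi> - g \<xi>)"
      using NR unfolding square_integrable_def integrable_iff_bounded N_def by simp
    then have d: "integrable lborel (\<lambda>\<xi>. (?F R f \<xi> - g \<xi>) * \<psi> \<xi>)"
      by (rule integrable_mult_of_square_integrable[OF _ \<psi>])
    have "(LINT \<xi>|lborel. ?F R f \<xi> * \<psi> \<xi>) = (LINT \<xi>|lborel. (?F R f \<xi> - g \<xi>) * \<psi> \<xi> + g \<xi> * \<psi> \<xi>)"
      by (simp add: algebra_simps)
    also have "\<dots> = (LINT \<xi>|lborel. (?F R f \<xi> - g \<xi>) * \<psi> \<xi>) + (LINT \<xi>|lborel. g \<xi> * \<psi> \<xi>)"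
      by (intro Bochner_Integration.integral_add d integrable_mult_of_square_integrable g \<psi>)
    finally have "ennreal (norm ((LINT \<xi>|lborel. ?F R f \<xi> * \<psi> \<xi>) - (LINT \<xi>|lborel. g \<xi> * \<psi> \<xi>)))
        = ennreal (norm (LINT \<xi>|lborel. (?F R f \<xi> - g \<xi>) * \<psi> \<xi>))" by simp
    also have "\<dots> \<le> (\<integral>\<^sup>+ \<xi>. ennreal (cmod (?F R f \<xi> - g \<xi>)) * ennreal (cmod (\<psi> \<xi>)) \<partial>lborel)"
      using integral_norm_bound_ennreal[OF d] by (simp add: norm_mult ennreal_mult)
    finally have "(ennreal (norm ((LINT \<xi>|lborel. ?F R f \<xi> * \<psi> \<xi>) - (LINT \<xi>|lborel. g \<xi> * \<psi> \<xi>))))\<^sup>2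
       \<le> (\<integral>\<^sup>+ \<xi>. ennreal (cmod (?F R f \<xi> - g \<xi>)) * ennreal (cmod (\<psi> \<xi>)) \<partial>lborel)\<^sup>2"
      by (rule power_mono) simp
    also have "\<dots> \<le> N R * C"
      using Cauchy_Schwarz_nn_integral[of "\<lambda>\<xi>. ennreal (cmod (?F R f \<xi> - g \<xi>))" lborel "\<lambda>\<xi>. ennreal (cmod (\<psi> \<xi>))"]
      by (simp add: N_def C_def ennreal_power)
    also have "\<dots> = ennreal (enn2real (N R) * enn2real C)"
      using NR C by (simp add: ennreal_mult)
    finally show ?thesis by (simp add: ennreal_power)
  qed
  have upper: "((\<lambda>R. enn2real (N R) * enn2real C) \<longlongrightarrow> 0) at_top"
    using N0 by (intro tendsto_mult_left_zero tendsto_enn2real) auto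
  have ev: "eventually (\<lambda>R. N R < 1) at_top"
    using order_tendstoD(2)[OF N0, of 1] by simp
  have "((\<lambda>R. (norm ((LINT \<xi>|lborel. ?F R f \<xi> * \<psi> \<xi>) - (LINT \<xi>|lborel. g \<xi> * \<psi> \<xi>)))\<^sup>2) \<longlongrightarrow> 0) at_top"
    by (rule tendsto_sandwich[OF always_eventually eventually_mono[OF ev bound] tendsto_const upper]) simp_all
  from tendsto_real_sqrt[OF this]
  have "((\<lambda>R. norm ((LINT \<xi>|lborel. ?F R f \<xi> * \<psi> \<xi>) - (LINT \<xi>|lborel. g \<xi> * \<psi> \<xi>))) \<longlongrightarrow> 0) at_top"
    unfolding real_sqrt_zero real_sqrt_power real_sqrt_abs by simp
  then show ?thesis
    unfolding tendsto_norm_zero_iff by (rule Lim_null[THEN iffD2])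
qed

text \<open>Pair the truncated transforms with a modulated Gaussian. All integrals then converge absolutely, so
  Fubini applies and produces the transform of the Gaussian, a rescaled Gaussian centred at \<open>x\<close>; removing
  the truncation gives the identity.\<close>
lemma regularised_fourier_inversion:
  fixes \<sigma> x :: real
  assumes fg: "is_fourier_transform f g" and \<sigma>: "\<sigma> > 0"
  shows "(LINT \<xi>|lborel. g \<xi> * (cis (x * \<xi>) * complex_of_real (exp (- (\<sigma> * \<xi>)\<^sup>2 / 2))))
       = complex_of_real (LINT y|lborel. f y * (exp (- ((x - y) / \<sigma>)\<^sup>2 / 2) / \<sigma>))"
proof -
  define \<psi> where "\<psi> \<xi> = cis (x * \<xi>) * complex_of_real (exp (- (\<sigma> * \<xi>)\<^sup>2 / 2))" for \<xi>
  define k where "k y = exp (- ((x - y) / \<sigma>)\<^sup>2 / 2) / \<sigma>" for y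
  have f: "square_integrable f" using fg by (auto simp: is_fourier_transform_def)
  then have [measurable]: "f \<in> borel_measurable borel" by (auto simp: square_integrable_def)
  have [measurable]: "cis \<in> borel_measurable borel"
    by (intro borel_measurable_continuous_onI continuous_intros)
  have [measurable]: "\<psi> \<in> borel_measurable borel" unfolding \<psi>_def by measurable
  have \<psi>: "square_integrable \<psi>"
  proof -
    have "(norm (\<psi> \<xi>))\<^sup>2 = exp (- (sqrt 2 * \<sigma> * \<xi>)\<^sup>2 / 2)" for \<xi>
      by (simp add: \<psi>_def norm_mult exp_of_nat_mult[symmetric] power_mult_distrib)
    then show ?thesis
      using integrable_gaussian[of "sqrt 2 * \<sigma>"] \<sigma> by (simp add: square_integrable_def)
  qed
  have trunc: "(LINT \<xi>|lborel. truncated_fourier R f \<xi> * \<psi> \<xi>) = complex_of_real (LINT y|lborel. indicator {-R..R} y * (f y * k y))" for R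
  proof -
    define a where "a y = complex_of_real (indicator {-R..R} y * f y)" for y
    have [measurable]: "a \<in> borel_measurable borel" unfolding a_def by measurable
    have inta: "integrable lborel (\<lambda>y. norm (a y))"
      using set_integrable_square_integrable[OF f, of R] unfolding a_def norm_of_real by (rule integrable_abs)
    define H where "H \<xi> y = a y * cis (- (y * \<xi>)) * \<psi> \<xi>" for \<xi> y
    have H: "integrable (lborel \<Otimes>\<^sub>M lborel) (case_prod H)"
    proof (rule lborel_pair.Fubini_integrable)
      show "case_prod H \<in> borel_measurable (lborel \<Otimes>\<^sub>M lborel)" unfolding H_def by measurable
      have n: "norm (H \<xi> y) = norm (a y) * exp (- (\<sigma> * \<xi>)\<^sup>2 / 2)" for \<xi> y
        by (simp add: H_def \<psi>_def norm_mult)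
      show "integrable lborel (\<lambda>\<xi>. LINT y|lborel. norm (case_prod H (\<xi>, y)))"
        using integrable_gaussian[of \<sigma>] \<sigma> by (simp add: n)
      show "AE \<xi> in lborel. integrable lborel (\<lambda>y. case_prod H (\<xi>, y))"
      proof (intro AE_I2)
        fix \<xi>
        have "integrable lborel (H \<xi>)"
        proof (rule Bochner_Integration.integrable_bound)
          show "integrable lborel (\<lambda>y. norm (a y) * exp (- (\<sigma> * \<xi>)\<^sup>2 / 2))" using inta by simp
          show "H \<xi> \<in> borel_measurable lborel" unfolding H_def by measurable
        qed (simp add: n)
        then show "integrable lborel (\<lambda>y. case_prod H (\<xi>, y))" by simp
      qed
    qed
    have inner: "(LINT \<xi>|lborel. H \<xi> y) = complex_of_real (sqrt (2 * pi)) * complex_of_real (indicator {-R..R} y * (f y * k y))" for y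
    proof -
      have "(LINT \<xi>|lborel. H \<xi> y) = (LINT \<xi>|lborel. a y * (cis ((x - y) * \<xi>) * complex_of_real (exp (- (\<sigma> * \<xi>)\<^sup>2 / 2))))"
      proof (intro Bochner_Integration.integral_cong refl)
        fix \<xi>
        have "cis ((x - y) * \<xi>) = cis (- (y * \<xi>)) * cis (x * \<xi>)" by (simp add: cis_mult left_diff_distrib)
        then show "H \<xi> y = a y * (cis ((x - y) * \<xi>) * complex_of_real (exp (- (\<sigma> * \<xi>)\<^sup>2 / 2)))"
          unfolding H_def \<psi>_def by (simp add: mult.assoc)
      qed
      also have "\<dots> = a y * complex_of_real (sqrt (2 * pi) / \<sigma> * exp (- ((x - y) / \<sigma>)\<^sup>2 / 2))"
        using fourier_gaussian[OF \<sigma>] by simp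
      finally show ?thesis by (simp add: a_def k_def)
    qed
    have "(LINT \<xi>|lborel. truncated_fourier R f \<xi> * \<psi> \<xi>) = (LINT \<xi>|lborel. (1 / sqrt (2 * pi)) *\<^sub>R (LINT y|lborel. H \<xi> y))"
      by (simp add: truncated_fourier_eq H_def a_def)
    also have "\<dots> = (1 / sqrt (2 * pi)) *\<^sub>R (LINT y|lborel. LINT \<xi>|lborel. H \<xi> y)"
      using lborel_pair.Fubini_integral[OF H] by simp
    also have "\<dots> = complex_of_real (LINT y|lborel. indicator {-R..R} y * (f y * k y))"
      by (simp add: inner scaleR_conv_of_real del: of_real_mult)
    finally show ?thesis .
  qed
  have fk: "integrable lborel (\<lambda>y. f y * k y)"
  proof -
    have "square_integrable (\<lambda>y. complex_of_real (f y))"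
      using f by (simp add: square_integrable_def)
    moreover have "square_integrable (\<lambda>y. complex_of_real (k y))"
    proof -
      have "(norm (complex_of_real (k y)))\<^sup>2 = exp (- (- (sqrt 2 * x / \<sigma>) + sqrt 2 / \<sigma> * y)\<^sup>2 / 2) / \<sigma>\<^sup>2" for y
      proof -
        have "- (sqrt 2 * x / \<sigma>) + sqrt 2 / \<sigma> * y = sqrt 2 * ((y - x) / \<sigma>)"
          by (simp add: diff_divide_distrib right_diff_distrib)
        then have "(- (sqrt 2 * x / \<sigma>) + sqrt 2 / \<sigma> * y)\<^sup>2 = 2 * ((x - y) / \<sigma>)\<^sup>2"
          by (simp add: power_mult_distrib power_divide power2_commute)
        moreover have "(k y)\<^sup>2 = exp (2 * (- ((x - y) / \<sigma>)\<^sup>2 / 2)) / \<sigma>\<^sup>2"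
          by (simp only: k_def exp_double power_divide)
        moreover have "(norm (complex_of_real (k y)))\<^sup>2 = (k y)\<^sup>2"
          by (simp only: norm_of_real power2_abs)
        ultimately show ?thesis by simp
      qed
      moreover have "integrable lborel (\<lambda>y. exp (- (- (sqrt 2 * x / \<sigma>) + sqrt 2 / \<sigma> * y)\<^sup>2 / 2))"
        using lborel_integrable_real_affine[OF integrable_gaussian[of 1], of "sqrt 2 / \<sigma>" "- (sqrt 2 * x / \<sigma>)"] \<sigma>
        by simp
      ultimately show ?thesis
        unfolding square_integrable_def by (simp add: k_def[abs_def])
    qed
    ultimately have "integrable lborel (\<lambda>y. complex_of_real (f y) * complex_of_real (k y))"
      by (rule integrable_mult_of_square_integrable)
    then have "integrable lborel (\<lambda>y. Re (complex_of_real (f y) * complex_of_real (k y)))" by (rule integrable_Re)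
    then show ?thesis by simp
  qed
  have "((\<lambda>R. LINT y|lborel. indicator {-R..R} y * (f y * k y)) \<longlongrightarrow> (LINT y|lborel. f y * k y)) at_top"
  proof (rule integral_dominated_convergence_at_top[where w = "\<lambda>y. norm (f y * k y)"])
    show "AE y in lborel. ((\<lambda>R. indicator {-R..R} y * (f y * k y)) \<longlongrightarrow> f y * k y) at_top"
    proof (intro AE_I2 tendsto_eventually)
      fix y :: real
      show "\<forall>\<^sub>F R in at_top. indicator {-R..R} y * (f y * k y) = f y * k y"
        using eventually_ge_at_top[of "\<bar>y\<bar>"] by eventually_elim (auto simp: indicator_def)
    qed
    show "\<forall>\<^sub>F R in at_top. AE y in lborel. norm (indicator {-R..R} y * (f y * k y)) \<le> norm (f y * k y)"
      by (auto simp: indicator_def)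
    show "integrable lborel (\<lambda>y. norm (f y * k y))" using fk by (rule integrable_norm)
  qed (auto simp: k_def)
  then have "((\<lambda>R. LINT \<xi>|lborel. truncated_fourier R f \<xi> * \<psi> \<xi>) \<longlongrightarrow> complex_of_real (LINT y|lborel. f y * k y)) at_top"
    unfolding trunc by (rule tendsto_of_real)
  from tendsto_unique[OF _ fourier_pairing_limit[OF fg \<psi>] this]
  show ?thesis by (simp add: \<psi>_def k_def)
qed

text \<open>As \<open>f\<close> need not be bounded, the integral is split at distance \<open>1\<close> from \<open>x\<close>. The near part converges by
  dominated convergence, because \<open>f\<close> is bounded on the compact interval; the far part is at most \<open>4/k\<close>
  times the fixed integral of \<open>f\<close> against a wide Gaussian.\<close>
lemma gaussian_approximate_identity:
  fixes f :: "real \<Rightarrow> real"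
  assumes cont: "continuous_on UNIV f" and f: "square_integrable f"
  shows "(\<lambda>n. LINT y|lborel. f y * (exp (- ((x - y) / inverse (real (Suc n)))\<^sup>2 / 2) / inverse (real (Suc n))))
    \<longlonglongrightarrow> sqrt (2 * pi) * f x"
proof -
  have [measurable]: "f \<in> borel_measurable borel" using f by (auto simp: square_integrable_def)
  define k where "k n = real (Suc n)" for n
  have k1: "k n \<ge> 1" for n by (simp add: k_def)
  define K where "K n y = k n * exp (- (k n * (x - y))\<^sup>2 / 2)" for n y
  define B where "B = {x - 1..x + 1}"
  define c where "c y = exp (- (- (x / sqrt 2) + 1 / sqrt 2 * y)\<^sup>2 / 2)" for y
  have c: "c y = exp (- (x - y)\<^sup>2 / 4)" for y
    by (simp add: c_def power2_eq_square field_simps)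
  have fc: "integrable lborel (\<lambda>y. \<bar>f y\<bar> * c y)"
  proof -
    have "integrable lborel (\<lambda>y. complex_of_real (f y) * complex_of_real (c y))"
    proof (rule integrable_mult_of_square_integrable)
      show "square_integrable (\<lambda>y. complex_of_real (f y))"
        using f by (simp add: square_integrable_def)
      have "(norm (complex_of_real (c y)))\<^sup>2 = exp (- (- x + 1 * y)\<^sup>2 / 2)" for y
        by (simp add: c exp_of_nat_mult[symmetric] power2_commute)
      then show "square_integrable (\<lambda>y. complex_of_real (c y))"
        using lborel_integrable_real_affine[OF integrable_gaussian[of 1], of 1 "- x"]
        unfolding square_integrable_def by (simp add: c_def[abs_def])
    qed
    then have "integrable lborel (\<lambda>y. norm (complex_of_real (f y) * complex_of_real (c y)))"
      by (rule integrable_norm)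
    then show ?thesis by (simp add: norm_mult c)
  qed
  define J where "J = (LINT y|lborel. \<bar>f y\<bar> * c y)"
  \<comment> \<open>Away from \<open>x\<close> the Gaussians tend to zero uniformly, even relative to a fixed Gaussian.\<close>
  have K_far: "K n y \<le> 4 / k n * c y" if "y \<notin> B" for n y
  proof -
    have w: "(x - y)\<^sup>2 \<ge> 1" using that abs_le_square_iff[of 1 "x - y"] by (auto simp: B_def)
    have "(k n)\<^sup>2 \<ge> 1" using k1[of n] by simp
    then have "(k n)\<^sup>2 * (x - y)\<^sup>2 \<ge> (x - y)\<^sup>2" "(k n)\<^sup>2 * (x - y)\<^sup>2 \<ge> (k n)\<^sup>2"
      using w by (auto simp: mult_le_cancel_right1 mult_le_cancel_left1)
    then have "- (k n * (x - y))\<^sup>2 / 2 \<le> - (k n)\<^sup>2 / 4 + - (x - y)\<^sup>2 / 4"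
      by (simp add: power_mult_distrib)
    then have "exp (- (k n * (x - y))\<^sup>2 / 2) \<le> exp (- (k n)\<^sup>2 / 4) * c y"
      unfolding c exp_add[symmetric] by simp
    moreover have "k n * exp (- (k n)\<^sup>2 / 4) \<le> 4 / k n"
    proof -
      have "(k n)\<^sup>2 / 4 \<le> exp ((k n)\<^sup>2 / 4)"
        using exp_ge_add_one_self[of "(k n)\<^sup>2 / 4"] by linarith
      then show ?thesis using k1[of n] by (simp add: exp_minus field_simps power2_eq_square)
    qed
    ultimately show ?thesis
      unfolding K_def using k1[of n] mult_left_mono[of _ _ "k n"] mult_right_mono[of _ _ "c y"]
      by (smt (verit) c exp_gt_zero mult.assoc)
  qed
  have K_near: "(\<lambda>n. LINT y|lborel. indicator B y * f y * K n y) \<longlonglongrightarrow> sqrt (2 * pi) * f x"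
  proof -
    obtain M where M: "\<And>y. y \<in> B \<Longrightarrow> \<bar>f y\<bar> \<le> M"
    proof -
      have "bounded (f ` B)"
        by (intro compact_imp_bounded compact_continuous_image continuous_on_subset[OF cont]) (auto simp: B_def)
      then show ?thesis using that by (auto simp: bounded_iff)
    qed
    have M0: "M \<ge> 0" using M[of x] by (auto simp: B_def)
    define S where "S n z = indicator B (x + z / k n) * f (x + z / k n) * exp (- z\<^sup>2 / 2)" for n z
    have "(LINT y|lborel. indicator B y * f y * K n y) = (LINT z|lborel. S n z)" for n
    proof -
      have "(LINT y|lborel. indicator B y * f y * K n y)
         = \<bar>1 / k n\<bar> *\<^sub>R (LINT z|lborel. indicator B (x + 1 / k n * z) * f (x + 1 / k n * z) * K n (x + 1 / k n * z))"
        using k1[of n] by (intro lborel_integral_real_affine) auto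
      also have "\<dots> = (LINT z|lborel. S n z)"
        using k1[of n] by (simp add: K_def S_def flip: integral_mult_right_zero)
          (auto intro!: Bochner_Integration.integral_cong simp: field_simps)
      finally show ?thesis .
    qed
    moreover have "(\<lambda>n. LINT z|lborel. S n z) \<longlonglongrightarrow> (LINT z|lborel. f x * exp (- z\<^sup>2 / 2))"
    proof (rule integral_dominated_convergence[where w = "\<lambda>z. M * exp (- (1 * z)\<^sup>2 / 2)"])
      show "integrable lborel (\<lambda>z. M * exp (- (1 * z)\<^sup>2 / 2))" using integrable_gaussian[of 1] by simp
      show "AE z in lborel. norm (S n z) \<le> M * exp (- (1 * z)\<^sup>2 / 2)" for n
        using M M0 by (auto simp: S_def abs_mult indicator_def intro!: mult_right_mono)
      show "AE z in lborel. (\<lambda>n. S n z) \<longlonglongrightarrow> f x * exp (- z\<^sup>2 / 2)"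
      proof (intro AE_I2)
        fix z :: real
        have "(\<lambda>n. 1 / k n) \<longlonglongrightarrow> 0" unfolding k_def inverse_eq_divide[symmetric] by (rule LIMSEQ_inverse_real_of_nat)
        from tendsto_add[OF tendsto_const tendsto_mult[OF tendsto_const this], of x z]
        have l: "(\<lambda>n. x + z / k n) \<longlonglongrightarrow> x" by simp
        have "(\<lambda>n. f (x + z / k n)) \<longlonglongrightarrow> f x"
          using continuous_on_tendsto_compose[OF cont l] by simp
        moreover have "eventually (\<lambda>n. x + z / k n \<in> {x - 1<..<x + 1}) sequentially"
          using topological_tendstoD[OF l, of "{x - 1<..<x + 1}"] by auto
        then have "(\<lambda>n. indicator B (x + z / k n) :: real) \<longlonglongrightarrow> 1"
          by (intro tendsto_eventually) (auto elim!: eventually_mono simp: B_def)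
        ultimately have "(\<lambda>n. S n z) \<longlonglongrightarrow> 1 * f x * exp (- z\<^sup>2 / 2)"
          unfolding S_def by (intro tendsto_intros)
        then show "(\<lambda>n. S n z) \<longlonglongrightarrow> f x * exp (- z\<^sup>2 / 2)" by simp
      qed
    qed (auto simp: S_def B_def)
    moreover have "(LINT z|lborel. f x * exp (- z\<^sup>2 / 2)) = sqrt (2 * pi) * f x"
    proof -
      have "(LINT z|lborel. f x * exp (- z\<^sup>2 / 2)) = (LINT z|lborel. (sqrt (2 * pi) * f x) * std_normal_density z)"
        by (intro Bochner_Integration.integral_cong) (auto simp: std_normal_density_def)
      then show ?thesis by simp
    qed
    ultimately show ?thesis by (simp only:)
  qed
  have far_bound: "\<bar>indicator (- B) y * f y * K n y\<bar> \<le> 4 / k n * (\<bar>f y\<bar> * c y)" for n y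
  proof (cases "y \<in> B")
    case True
    have "0 \<le> 4 / k n * (\<bar>f y\<bar> * c y)" using k1[of n] by (simp add: c)
    then show ?thesis using True by simp
  next
    case False
    have "K n y \<ge> 0" using k1[of n] by (simp add: K_def)
    then have "\<bar>indicator (- B) y * f y * K n y\<bar> = \<bar>f y\<bar> * K n y"
      using False by (simp add: abs_mult)
    also have "\<dots> \<le> \<bar>f y\<bar> * (4 / k n * c y)"
      by (intro mult_left_mono K_far False) simp
    finally show ?thesis by (simp only: mult.left_commute)
  qed
  have [measurable]: "(\<lambda>y. indicator (- B) y * f y * K n y) \<in> borel_measurable borel"
     "(\<lambda>y. indicator B y * f y * K n y) \<in> borel_measurable borel" for n
    unfolding K_def B_def by measurable
  have far_int: "integrable lborel (\<lambda>y. indicator (- B) y * f y * K n y)" for n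
  proof (rule Bochner_Integration.integrable_bound)
    show "integrable lborel (\<lambda>y. 4 / k n * (\<bar>f y\<bar> * c y))" using fc by simp
    show "AE y in lborel. norm (indicator (- B) y * f y * K n y) \<le> norm (4 / k n * (\<bar>f y\<bar> * c y))"
      by (intro AE_I2) (simp only: real_norm_def order_trans[OF far_bound abs_ge_self])
  qed simp
  have "(\<lambda>n. LINT y|lborel. indicator (- B) y * f y * K n y) \<longlonglongrightarrow> 0"
  proof (rule Lim_null_comparison)
    show "\<forall>\<^sub>F n in sequentially. norm (LINT y|lborel. indicator (- B) y * f y * K n y) \<le> (1 / k n) * (4 * J)"
    proof (intro always_eventually allI)
      fix n
      have "norm (LINT y|lborel. indicator (- B) y * f y * K n y) \<le> (LINT y|lborel. 4 / k n * (\<bar>f y\<bar> * c y))"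
      proof (rule Bochner_Integration.integral_norm_bound_integral[OF far_int])
        show "integrable lborel (\<lambda>y. 4 / k n * (\<bar>f y\<bar> * c y))" using fc by simp
        show "norm (indicator (- B) y * f y * K n y) \<le> 4 / k n * (\<bar>f y\<bar> * c y)" for y
          unfolding real_norm_def by (rule far_bound)
      qed
      also have "(LINT y|lborel. 4 / k n * (\<bar>f y\<bar> * c y)) = (1 / k n) * (4 * J)"
        by (simp add: J_def)
      finally show "norm (LINT y|lborel. indicator (- B) y * f y * K n y) \<le> (1 / k n) * (4 * J)" .
    qed
    have "(\<lambda>n. 1 / k n) \<longlonglongrightarrow> 0" unfolding k_def inverse_eq_divide[symmetric] by (rule LIMSEQ_inverse_real_of_nat)
    then show "(\<lambda>n. (1 / k n) * (4 * J)) \<longlonglongrightarrow> 0" by (rule tendsto_mult_left_zero)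
  qed
  from tendsto_add[OF K_near this]
  have lim: "(\<lambda>n. (LINT y|lborel. indicator B y * f y * K n y) + (LINT y|lborel. indicator (- B) y * f y * K n y))
     \<longlonglongrightarrow> sqrt (2 * pi) * f x" unfolding add_0_right .
  have near_int: "integrable lborel (\<lambda>y. indicator B y * f y * K n y)" for n
  proof -
    have "integrable lborel (\<lambda>y. indicator B y *\<^sub>R (f y * K n y))"
      unfolding B_def set_integrable_def[symmetric]
    proof (rule borel_integrable_atLeastAtMost')
      show "continuous_on {x - 1..x + 1} (\<lambda>y. f y * K n y)"
        unfolding K_def by (rule continuous_on_mult[OF continuous_on_subset[OF cont]]) (auto intro!: continuous_intros)
    qed
    then show ?thesis by (simp only: real_scaleR_def mult.assoc)
  qed
  have sum: "(LINT y|lborel. f y * (exp (- ((x - y) / inverse (k n))\<^sup>2 / 2) / inverse (k n)))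
      = (LINT y|lborel. indicator B y * f y * K n y) + (LINT y|lborel. indicator (- B) y * f y * K n y)" for n
  proof -
    have "f y * (exp (- ((x - y) / inverse (k n))\<^sup>2 / 2) / inverse (k n)) = f y * K n y" for y
      unfolding K_def divide_inverse inverse_inverse_eq by (simp only: mult.commute)
    also have "f y * K n y = indicator B y * f y * K n y + indicator (- B) y * f y * K n y" for y
      by (cases "y \<in> B") simp_all
    finally show ?thesis
      by (simp only: Bochner_Integration.integral_add[OF near_int far_int])
  qed
  show ?thesis using lim unfolding sum[symmetric] unfolding k_def .
qed

text \<open>Let the width of the Gaussian in \<open>regularised_fourier_inversion\<close> tend to zero on both sides.\<close>
theorem fourier_inversion:
  assumes fg: "is_fourier_transform f g" and cont: "continuous_on UNIV f" and g: "integrable lborel g"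
  shows "complex_of_real (f x) = (1 / sqrt (2 * pi)) *\<^sub>R (LINT \<xi>|lborel. g \<xi> * cis (x * \<xi>))"
proof -
  define \<sigma> where "\<sigma> n = inverse (real (Suc n))" for n
  have f: "square_integrable f" using fg by (simp add: is_fourier_transform_def)
  note [measurable] = borel_measurable_integrable[OF g]
  have [measurable]: "cis \<in> borel_measurable borel"
    by (intro borel_measurable_continuous_onI continuous_intros)
  have lim: "(\<lambda>n. LINT \<xi>|lborel. g \<xi> * (cis (x * \<xi>) * complex_of_real (exp (- (\<sigma> n * \<xi>)\<^sup>2 / 2))))
      \<longlonglongrightarrow> (LINT \<xi>|lborel. g \<xi> * cis (x * \<xi>))"
  proof (rule integral_dominated_convergence[where w = "\<lambda>\<xi>. norm (g \<xi>)"])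
    show "AE \<xi> in lborel. (\<lambda>n. g \<xi> * (cis (x * \<xi>) * complex_of_real (exp (- (\<sigma> n * \<xi>)\<^sup>2 / 2)))) \<longlonglongrightarrow> g \<xi> * cis (x * \<xi>)"
    proof (intro AE_I2)
      fix \<xi>
      have "\<sigma> \<longlonglongrightarrow> 0" unfolding \<sigma>_def by (rule LIMSEQ_inverse_real_of_nat)
      then have "(\<lambda>n. g \<xi> * (cis (x * \<xi>) * complex_of_real (exp (- (\<sigma> n * \<xi>)\<^sup>2 / 2)))) \<longlonglongrightarrow>
         g \<xi> * (cis (x * \<xi>) * complex_of_real (exp (- (0 * \<xi>)\<^sup>2 / 2)))"
        by (intro tendsto_intros) auto
      then show "(\<lambda>n. g \<xi> * (cis (x * \<xi>) * complex_of_real (exp (- (\<sigma> n * \<xi>)\<^sup>2 / 2)))) \<longlonglongrightarrow> g \<xi> * cis (x * \<xi>)"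
        by simp
    qed
  qed (use g in \<open>auto simp: norm_mult mult_left_le\<close>)

  have "\<sigma> n > 0" for n by (simp add: \<sigma>_def)
  note lim[unfolded regularised_fourier_inversion[OF fg this]]
  moreover have "(\<lambda>n. complex_of_real (LINT y|lborel. f y * (exp (- ((x - y) / \<sigma> n)\<^sup>2 / 2) / \<sigma> n)))
     \<longlonglongrightarrow> complex_of_real (sqrt (2 * pi) * f x)"
    unfolding \<sigma>_def by (intro tendsto_of_real gaussian_approximate_identity cont f)
  ultimately have "(LINT \<xi>|lborel. g \<xi> * cis (x * \<xi>)) = complex_of_real (sqrt (2 * pi) * f x)"
    by (rule LIMSEQ_unique)
  then show ?thesis
    by (simp only: scaleR_conv_of_real of_real_mult[symmetric]) simp
qed

section \<open>Sobolev embedding\<close>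

lemma integrable_japanese_bracket_powr:
  fixes r :: real
  assumes r: "r > 1/2"
  shows "integrable lborel (\<lambda>\<xi>::real. (1 + \<xi>\<^sup>2) powr (- r))"
proof -
  define p where "p \<xi> = indicator {1..} \<xi> * \<xi> powr (- 2 * r)" for \<xi> :: real
  have "(\<lambda>\<xi>::real. \<xi> powr (- 2 * r)) integrable_on {1..}"
    using has_integral_powr_to_inf[of "- 2 * r" 1] r by (auto simp: integrable_on_def)
  then have "set_integrable lebesgue {1..} (\<lambda>\<xi>::real. \<xi> powr (- 2 * r))"
    by (intro nonnegative_absolutely_integrable_1) auto
  then have "integrable lebesgue p" by (simp add: set_integrable_def p_def[abs_def])
  then have p: "integrable lborel p"
    by (subst (asm) integrable_completion) (auto simp: p_def[abs_def])
  have p': "integrable lborel (\<lambda>\<xi>. p (- \<xi>))"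
    using lborel_integrable_real_affine[OF p, of "-1" 0] by simp
  have i: "integrable lborel (indicator {-1..1} :: real \<Rightarrow> real)"
    by (intro integrable_real_indicator) (auto simp: emeasure_lborel_Icc_eq)
  have le: "(1 + \<xi>\<^sup>2) powr (- r) \<le> indicator {-1..1} \<xi> + p \<xi> + p (- \<xi>)" for \<xi> :: real
  proof (cases "\<bar>\<xi>\<bar> \<le> 1")
    case True
    have "(1 + \<xi>\<^sup>2) powr (- r) \<le> 1 powr (- r)"
      using r by (intro powr_mono2') auto
    then show ?thesis using True by (auto simp: p_def indicator_def add_increasing2)
  next
    case False
    have "(1 + \<xi>\<^sup>2) powr (- r) \<le> (\<bar>\<xi>\<bar> powr 2) powr (- r)"
      using r False by (intro powr_mono2') auto
    also have "\<dots> = \<bar>\<xi>\<bar> powr (- 2 * r)" by (simp only: powr_powr) simp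
    finally show ?thesis using False by (auto simp: p_def indicator_def split: if_splits)
  qed
  show ?thesis
  proof (rule Bochner_Integration.integrable_bound)
    show "integrable lborel (\<lambda>\<xi>. indicator {-1..1} \<xi> + p \<xi> + p (- \<xi>))"
      using p p' i by simp
    show "AE \<xi> in lborel. norm ((1 + \<xi>\<^sup>2) powr (- r)) \<le> norm (indicator {-1..1} \<xi> + p \<xi> + p (- \<xi>))"
    proof (intro AE_I2)
      fix \<xi> :: real
      have "norm ((1 + \<xi>\<^sup>2) powr (- r)) = (1 + \<xi>\<^sup>2) powr (- r)" by simp
      also note le[of \<xi>]
      also note abs_ge_self
      finally show "norm ((1 + \<xi>\<^sup>2) powr (- r)) \<le> norm (indicator {-1..1} \<xi> + p \<xi> + p (- \<xi>))"
        unfolding real_norm_def .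
    qed
  qed simp
qed

lemma integral_Cauchy_Schwarz:
  fixes f g :: "real \<Rightarrow> real"
  assumes [measurable]: "f \<in> borel_measurable lborel" "g \<in> borel_measurable lborel"
    and f: "integrable lborel (\<lambda>x. (f x)\<^sup>2)" and g: "integrable lborel (\<lambda>x. (g x)\<^sup>2)"
  shows "integrable lborel (\<lambda>x. \<bar>f x * g x\<bar>)"
    and "(LINT x|lborel. \<bar>f x * g x\<bar>) \<le> sqrt (LINT x|lborel. (f x)\<^sup>2) * sqrt (LINT x|lborel. (g x)\<^sup>2)"
proof -
  let ?I = "\<integral>\<^sup>+x. ennreal \<bar>f x\<bar> * ennreal \<bar>g x\<bar> \<partial>lborel"
  have "?I\<^sup>2 \<le> (\<integral>\<^sup>+x. ennreal \<bar>f x\<bar> ^ 2 \<partial>lborel) * (\<integral>\<^sup>+x. ennreal \<bar>g x\<bar> ^ 2 \<partial>lborel)"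
    by (rule Cauchy_Schwarz_nn_integral) auto
  also have "\<dots> = ennreal ((LINT x|lborel. (f x)\<^sup>2) * (LINT x|lborel. (g x)\<^sup>2))"
    using nn_integral_eq_integral[OF f] nn_integral_eq_integral[OF g]
    by (simp add: ennreal_power ennreal_mult)
  finally have sq: "?I\<^sup>2 \<le> ennreal ((LINT x|lborel. (f x)\<^sup>2) * (LINT x|lborel. (g x)\<^sup>2))" .
  have "?I\<^sup>2 < top" by (rule le_less_trans[OF sq ennreal_less_top])
  then have fin: "?I < \<infinity>" by (simp add: power_less_top_ennreal)
  from fin show int: "integrable lborel (\<lambda>x. \<bar>f x * g x\<bar>)"
    by (intro integrableI_bounded) (auto simp: abs_mult ennreal_mult)
  have "?I = ennreal (LINT x|lborel. \<bar>f x * g x\<bar>)"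
    using nn_integral_eq_integral[OF int] by (simp add: abs_mult ennreal_mult)
  with sq have "(LINT x|lborel. \<bar>f x * g x\<bar>)\<^sup>2 \<le> (LINT x|lborel. (f x)\<^sup>2) * (LINT x|lborel. (g x)\<^sup>2)"
    by (simp add: ennreal_power)
  then show "(LINT x|lborel. \<bar>f x * g x\<bar>) \<le> sqrt (LINT x|lborel. (f x)\<^sup>2) * sqrt (LINT x|lborel. (g x)\<^sup>2)"
    unfolding real_sqrt_mult[symmetric] by (rule real_le_rsqrt)
qed

lemma one_plus_square_neq_0 [simp]: "1 + x\<^sup>2 \<noteq> (0::real)"
  using zero_le_power2[of x] by linarith

text \<open>The Cauchy--Schwarz inequality, with the weight split so that one factor is the Sobolev density and the
  other a power of \<open>1 + \<xi>\<^sup>2\<close> that is integrable because of the gap between \<open>r\<close> and \<open>2 q\<close>. The value \<open>q = 0\<close> serves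
  for functions and \<open>q = 1/2\<close> for their derivatives.\<close>
lemma weighted_fourier_L1_bound:
  fixes g :: "real \<Rightarrow> complex" and q r :: real
  assumes [measurable]: "g \<in> borel_measurable borel"
    and g: "integrable lborel (\<lambda>\<xi>. (1 + \<xi>\<^sup>2) powr r * (cmod (g \<xi>))\<^sup>2)"
    and q: "r - 2 * q > 1/2"
  shows "integrable lborel (\<lambda>\<xi>. (1 + \<xi>\<^sup>2) powr q * cmod (g \<xi>))"
    and "(LINT \<xi>|lborel. (1 + \<xi>\<^sup>2) powr q * cmod (g \<xi>))
      \<le> sqrt (LINT \<xi>|lborel. (1 + \<xi>\<^sup>2) powr (- (r - 2 * q))) * sqrt (LINT \<xi>|lborel. (1 + \<xi>\<^sup>2) powr r * (cmod (g \<xi>))\<^sup>2)"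
proof -
  define a where "a \<xi> = (1 + \<xi>\<^sup>2) powr (q - r / 2)" for \<xi> :: real
  define b where "b \<xi> = (1 + \<xi>\<^sup>2) powr (r / 2) * cmod (g \<xi>)" for \<xi> :: real
  have a2: "(a \<xi>)\<^sup>2 = (1 + \<xi>\<^sup>2) powr (- (r - 2 * q))" for \<xi>
    by (simp add: a_def power2_eq_square powr_add[symmetric] algebra_simps)
  have b2: "(b \<xi>)\<^sup>2 = (1 + \<xi>\<^sup>2) powr r * (cmod (g \<xi>))\<^sup>2" for \<xi>
  proof -
    have "((1 + \<xi>\<^sup>2) powr (r / 2))\<^sup>2 = (1 + \<xi>\<^sup>2) powr r"
      by (simp add: power2_eq_square powr_add[symmetric])
    then show ?thesis by (simp add: b_def power_mult_distrib)
  qed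
  have ab: "\<bar>a \<xi> * b \<xi>\<bar> = (1 + \<xi>\<^sup>2) powr q * cmod (g \<xi>)" for \<xi>
  proof -
    have "(1 + \<xi>\<^sup>2) powr (q - r / 2) * (1 + \<xi>\<^sup>2) powr (r / 2) = (1 + \<xi>\<^sup>2) powr q"
      by (simp add: powr_add[symmetric])
    then show ?thesis by (simp add: a_def b_def abs_mult flip: mult.assoc)
  qed
  have "integrable lborel (\<lambda>\<xi>. (a \<xi>)\<^sup>2)" "integrable lborel (\<lambda>\<xi>. (b \<xi>)\<^sup>2)"
    using integrable_japanese_bracket_powr[OF q] g by (simp_all only: a2 b2)
  moreover have "a \<in> borel_measurable lborel" "b \<in> borel_measurable lborel"
    unfolding a_def b_def by measurable
  ultimately show "integrable lborel (\<lambda>\<xi>. (1 + \<xi>\<^sup>2) powr q * cmod (g \<xi>))"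
    and "(LINT \<xi>|lborel. (1 + \<xi>\<^sup>2) powr q * cmod (g \<xi>))
      \<le> sqrt (LINT \<xi>|lborel. (1 + \<xi>\<^sup>2) powr (- (r - 2 * q))) * sqrt (LINT \<xi>|lborel. (1 + \<xi>\<^sup>2) powr r * (cmod (g \<xi>))\<^sup>2)"
    using integral_Cauchy_Schwarz[of a b] by (simp_all only: ab a2 b2)
qed

lemma sobolev_norm_transform:
  assumes "f \<in> sobolev r"
  obtains g where "is_fourier_transform f g" "integrable lborel (\<lambda>\<xi>. (1 + \<xi>\<^sup>2) powr r * (cmod (g \<xi>))\<^sup>2)"
    "sobolev_norm r f = sqrt (LINT \<xi>|lborel. (1 + \<xi>\<^sup>2) powr r * (cmod (g \<xi>))\<^sup>2)"
proof -
  obtain k where k: "is_fourier_transform f k" "integrable lborel (\<lambda>\<xi>. (1 + \<xi>\<^sup>2) powr r * (cmod (k \<xi>))\<^sup>2)"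
    using assms by (auto simp: sobolev_def)
  define g where "g = (SOME g. is_fourier_transform f g)"
  have g: "is_fourier_transform f g" unfolding g_def by (rule someI[of "is_fourier_transform f", OF k(1)])
  have [measurable]: "g \<in> borel_measurable borel" "k \<in> borel_measurable borel"
    using g k(1) by (auto simp: is_fourier_transform_def square_integrable_def)
  have "integrable lborel (\<lambda>\<xi>. (1 + \<xi>\<^sup>2) powr r * (cmod (g \<xi>))\<^sup>2)
    \<longleftrightarrow> integrable lborel (\<lambda>\<xi>. (1 + \<xi>\<^sup>2) powr r * (cmod (k \<xi>))\<^sup>2)"
    using is_fourier_transform_unique[OF g k(1)] by (intro integrable_cong_AE) auto
  with k(2) g show ?thesis by (intro that) (auto simp: sobolev_norm_def g_def)
qed

text \<open>The transform is integrable, so inversion bounds the function by the \<open>L\<^sup>1\<close> norm of its transform. The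
  function \<open>h\<close> is the continuous representative of \<open>f\<close>.\<close>
theorem sobolev_sup_bound:
  fixes r :: real
  assumes r: "r > 1/2"
  obtains C where "C \<ge> 0" "\<And>f h x. f \<in> sobolev r \<Longrightarrow> continuous_on UNIV h \<Longrightarrow> (AE y in lborel. f y = h y) \<Longrightarrow>
    \<bar>h x\<bar> \<le> C * sobolev_norm r f"
proof
  define C where "C = sqrt (LINT \<xi>|lborel. (1 + \<xi>\<^sup>2) powr (- r)) / sqrt (2 * pi)"
  show "C \<ge> 0" by (simp add: C_def)
  fix f h :: "real \<Rightarrow> real" and x :: real
  assume f: "f \<in> sobolev r" and h: "continuous_on UNIV h" and AE: "AE y in lborel. f y = h y"
  obtain g where g: "is_fourier_transform f g" "integrable lborel (\<lambda>\<xi>. (1 + \<xi>\<^sup>2) powr r * (cmod (g \<xi>))\<^sup>2)"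
    "sobolev_norm r f = sqrt (LINT \<xi>|lborel. (1 + \<xi>\<^sup>2) powr r * (cmod (g \<xi>))\<^sup>2)"
    by (rule sobolev_norm_transform[OF f])
  have [measurable]: "g \<in> borel_measurable borel"
    using g(1) by (auto simp: is_fourier_transform_def square_integrable_def)
  have hg: "is_fourier_transform h g"
    by (rule is_fourier_transform_AE_cong[OF g(1) borel_measurable_continuous_onI[OF h] AE])
  note L1 = weighted_fourier_L1_bound[OF _ g(2), of 0]
  have int: "integrable lborel (\<lambda>\<xi>. cmod (g \<xi>))" using L1(1) r by simp
  then have intg: "integrable lborel g" by (simp add: integrable_norm_iff)
  have "\<bar>h x\<bar> = cmod (complex_of_real (h x))" by simp
  also have "\<dots> = (1 / sqrt (2 * pi)) * cmod (LINT \<xi>|lborel. g \<xi> * cis (x * \<xi>))"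
    by (simp add: fourier_inversion[OF hg h intg])
  also have "\<dots> \<le> (1 / sqrt (2 * pi)) * (LINT \<xi>|lborel. cmod (g \<xi>))"
    using integral_norm_bound[of lborel "\<lambda>\<xi>. g \<xi> * cis (x * \<xi>)"]
    by (intro mult_left_mono) (auto simp: norm_mult)
  also have "\<dots> \<le> (1 / sqrt (2 * pi)) * (sqrt (LINT \<xi>|lborel. (1 + \<xi>\<^sup>2) powr (- r)) * sobolev_norm r f)"
    unfolding g(3) using L1(2) r by (intro mult_left_mono) auto
  finally show "\<bar>h x\<bar> \<le> C * sobolev_norm r f" by (simp add: C_def)
qed

lemma has_real_derivative_lebesgue_integral:
  fixes F F' :: "real \<Rightarrow> 'a \<Rightarrow> real"
  assumes int: "\<And>x. integrable M (F x)"
    and deriv: "\<And>x y. ((\<lambda>x. F x y) has_real_derivative F' x y) (at x)"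
    and F': "\<And>x. F' x \<in> borel_measurable M"
    and bound: "\<And>x y. \<bar>F' x y\<bar> \<le> w y" and w: "integrable M w"
  shows "((\<lambda>x. integral\<^sup>L M (F x)) has_real_derivative integral\<^sup>L M (F' x)) (at x)"
  unfolding DERIV_def tendsto_at_iff_sequentially comp_def
proof (intro allI impI)
  fix X :: "nat \<Rightarrow> real"
  assume X: "\<forall>i. X i \<in> UNIV - {0}" "X \<longlonglongrightarrow> 0"
  have "(\<lambda>i. LINT y|M. (F (x + X i) y - F x y) / X i) \<longlonglongrightarrow> integral\<^sup>L M (F' x)"
  proof (rule integral_dominated_convergence[OF F' _ w])
    show "(\<lambda>y. (F (x + X i) y - F x y) / X i) \<in> borel_measurable M" for i
      using int by (intro borel_measurable_divide borel_measurable_diff borel_measurable_integrable) auto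
    show "AE y in M. (\<lambda>i. (F (x + X i) y - F x y) / X i) \<longlonglongrightarrow> F' x y"
      using deriv X unfolding DERIV_def tendsto_at_iff_sequentially comp_def by auto
    show "AE y in M. norm ((F (x + X i) y - F x y) / X i) \<le> w y" for i
    proof (intro AE_I2)
      fix y
      have "norm (F (x + X i) y - F x y) \<le> w y * norm (x + X i - x)"
        by (rule field_differentiable_bound[where S = UNIV and f' = "\<lambda>x. F' x y"])
           (use deriv bound in \<open>auto intro: has_field_derivative_at_within\<close>)
      then show "norm ((F (x + X i) y - F x y) / X i) \<le> w y"
        using X(1) by (simp add: divide_le_eq)
    qed
  qed
  then show "(\<lambda>i. (integral\<^sup>L M (F (x + X i)) - integral\<^sup>L M (F x)) / X i) \<longlonglongrightarrow> integral\<^sup>L M (F' x)"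
    using int by simp
qed

text \<open>Differentiation under the integral sign in the inversion formula; \<open>\<bar>\<xi>\<bar> \<bar>g \<xi>\<bar>\<close> is integrable because
  \<open>r - 1 > 1/2\<close>.\<close>
theorem sobolev_deriv_bound:
  fixes r :: real
  assumes r: "r > 3/2"
  obtains C where "C \<ge> 0" "\<And>f x. f \<in> sobolev r \<Longrightarrow> continuous_on UNIV f \<Longrightarrow>
      (f has_real_derivative deriv f x) (at x)"
    "\<And>f x. f \<in> sobolev r \<Longrightarrow> continuous_on UNIV f \<Longrightarrow> \<bar>deriv f x\<bar> \<le> C * sobolev_norm r f"
    "\<And>f. f \<in> sobolev r \<Longrightarrow> continuous_on UNIV f \<Longrightarrow> continuous_on UNIV (deriv f)"
proof -
  define C where "C = sqrt (LINT \<xi>|lborel. (1 + \<xi>\<^sup>2) powr (- (r - 1))) / sqrt (2 * pi)"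
  have main: "(f has_real_derivative deriv f x) (at x) \<and> \<bar>deriv f x\<bar> \<le> C * sobolev_norm r f \<and> isCont (deriv f) x"
    if f: "f \<in> sobolev r" and cont: "continuous_on UNIV f" for f x
  proof -
    obtain g where g: "is_fourier_transform f g" "integrable lborel (\<lambda>\<xi>. (1 + \<xi>\<^sup>2) powr r * (cmod (g \<xi>))\<^sup>2)"
      "sobolev_norm r f = sqrt (LINT \<xi>|lborel. (1 + \<xi>\<^sup>2) powr r * (cmod (g \<xi>))\<^sup>2)"
      by (rule sobolev_norm_transform[OF f])
    have [measurable]: "g \<in> borel_measurable borel"
      using g(1) by (auto simp: is_fourier_transform_def square_integrable_def)
    have [measurable]: "cis \<in> borel_measurable borel"
      by (intro borel_measurable_continuous_onI continuous_intros)
    define w where "w \<xi> = (1 + \<xi>\<^sup>2) powr (1/2) * cmod (g \<xi>)" for \<xi> :: real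
    have w: "integrable lborel w"
      unfolding w_def by (rule weighted_fourier_L1_bound(1)[OF _ g(2)]) (use r in auto)
    have wle: "(LINT \<xi>|lborel. w \<xi>) \<le> sqrt (LINT \<xi>|lborel. (1 + \<xi>\<^sup>2) powr (- (r - 1))) * sobolev_norm r f"
      using weighted_fourier_L1_bound(2)[OF _ g(2), of "1/2"] r unfolding g(3) w_def by simp
    have intg: "integrable lborel g"
      using weighted_fourier_L1_bound(1)[OF _ g(2), of 0] r by (simp add: integrable_norm_iff)
    define F where "F x \<xi> = Re (g \<xi> * cis (x * \<xi>))" for x \<xi>
    define F' where "F' x \<xi> = Re (\<i> * \<xi> * g \<xi> * cis (x * \<xi>))" for x \<xi>
    have intF: "integrable lborel (\<lambda>\<xi>. g \<xi> * cis (x * \<xi>))" for x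
      by (rule Bochner_Integration.integrable_bound[OF intg]) (auto simp: norm_mult)
    then have iF: "integrable lborel (F x)" for x
      unfolding F_def by (rule integrable_Re)
    have dF: "((\<lambda>x. F x \<xi>) has_real_derivative F' x \<xi>) (at x)" for x \<xi>
      unfolding F_def F'_def by (auto intro!: derivative_eq_intros simp: algebra_simps)
    have mF': "F' x \<in> borel_measurable lborel" for x unfolding F'_def by measurable
    have bF': "\<bar>F' x \<xi>\<bar> \<le> w \<xi>" for x \<xi>
    proof -
      have "\<bar>F' x \<xi>\<bar> \<le> cmod (\<i> * \<xi> * g \<xi> * cis (x * \<xi>))" unfolding F'_def by (rule abs_Re_le_cmod)
      also have "\<dots> = \<bar>\<xi>\<bar> * cmod (g \<xi>)" by (simp add: norm_mult)
      also have "\<dots> \<le> w \<xi>"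
        unfolding w_def by (intro mult_right_mono) (auto simp: powr_half_sqrt intro!: real_le_rsqrt)
      finally show ?thesis .
    qed
    have fx: "f x = (1 / sqrt (2 * pi)) * integral\<^sup>L lborel (F x)" for x
      using arg_cong[OF fourier_inversion[OF g(1) cont intg, of x], of Re] integral_Re[OF intF[of x]]
      by (simp add: F_def[abs_def])
    have D: "(f has_real_derivative (1 / sqrt (2 * pi)) * integral\<^sup>L lborel (F' x)) (at x)" for x
      unfolding fx[abs_def]
      by (intro DERIV_cmult has_real_derivative_lebesgue_integral[where w = w] iF dF mF' bF' w)
    then have df: "deriv f x = (1 / sqrt (2 * pi)) * integral\<^sup>L lborel (F' x)" for x
      by (rule DERIV_imp_deriv)
    have "\<bar>integral\<^sup>L lborel (F' x)\<bar> \<le> (LINT \<xi>|lborel. w \<xi>)"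
    proof -
      have "integrable lborel (F' x)"
        by (rule Bochner_Integration.integrable_bound[OF w mF'])
          (use bF' in \<open>auto intro: order_trans[OF _ abs_ge_self]\<close>)
      from Bochner_Integration.integral_norm_bound_integral[OF this w, unfolded real_norm_def, OF bF'] show ?thesis .
    qed
    then have "\<bar>deriv f x\<bar> \<le> (1 / sqrt (2 * pi)) * (sqrt (LINT \<xi>|lborel. (1 + \<xi>\<^sup>2) powr (- (r - 1))) * sobolev_norm r f)"
      unfolding df abs_mult using wle by (intro mult_mono) auto
    moreover have "isCont (deriv f) x"
      unfolding continuous_at_sequentially comp_def
    proof (intro allI impI)
      fix X assume X: "X \<longlonglongrightarrow> x"
      have "(\<lambda>n. integral\<^sup>L lborel (F' (X n))) \<longlonglongrightarrow> integral\<^sup>L lborel (F' x)"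
      proof (rule integral_dominated_convergence[where w = w, OF mF' mF' w])
        show "AE \<xi> in lborel. (\<lambda>n. F' (X n) \<xi>) \<longlonglongrightarrow> F' x \<xi>"
          unfolding F'_def
        proof (intro AE_I2 tendsto_Re tendsto_mult tendsto_const)
          fix \<xi>
          have "isCont cis (x * \<xi>)"
            using continuous_on_cis[OF continuous_on_id, of UNIV] by (simp add: continuous_on_eq_continuous_at)
          then show "(\<lambda>n. cis (X n * \<xi>)) \<longlonglongrightarrow> cis (x * \<xi>)"
            by (rule isCont_tendsto_compose) (intro tendsto_mult X tendsto_const)
        qed
        show "AE \<xi> in lborel. norm (F' (X n) \<xi>) \<le> w \<xi>" for n using bF' by simp
      qed
      then show "(\<lambda>n. deriv f (X n)) \<longlonglongrightarrow> deriv f x" unfolding df by (intro tendsto_mult tendsto_const)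
    qed
    ultimately show ?thesis using D[of x, folded df] by (simp add: C_def)
  qed
  show ?thesis
  proof (rule that[of C])
    show "C \<ge> 0" by (simp add: C_def)
  qed (use main in \<open>auto simp: continuous_on_eq_continuous_at\<close>)
qed

section \<open>A first-contact principle\<close>

text \<open>Among the points with \<open>w \<ge> 0\<close>, which form a compact set, choose one with the smallest time. Before
  that time \<open>w\<close> is negative, so at it \<open>w\<close> has a spatial maximum with value \<open>0\<close>; there its time derivative
  cannot be negative.\<close>
lemma negative_by_first_contact:
  fixes w :: "real \<Rightarrow> real \<Rightarrow> real"
  assumes cont: "continuous_on ({0..T} \<times> UNIV) (\<lambda>p. w (fst p) (snd p))"
    and init: "\<And>x. w 0 x < 0"
    and far: "\<And>t x. t \<in> {0..T} \<Longrightarrow> R < \<bar>x\<bar> \<Longrightarrow> w t x < 0"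
    and diff: "\<And>t x. t \<in> {0..T} \<Longrightarrow> \<exists>D. (w t has_real_derivative D) (at x)"
    and touch: "\<And>t x. 0 < t \<Longrightarrow> t \<le> T \<Longrightarrow> w t x = 0 \<Longrightarrow> (w t has_real_derivative 0) (at x) \<Longrightarrow>
      \<exists>D<0. ((\<lambda>\<tau>. w \<tau> x) has_real_derivative D) (at t within {0..T})"
    and t: "t \<in> {0..T}"
  shows "w t x < 0"
proof (rule ccontr)
  assume neg: "\<not> w t x < 0"
  define K where "K = {p \<in> {0..T} \<times> {-R..R}. 0 \<le> w (fst p) (snd p)}"
  have "closed K"
    unfolding K_def
    by (intro continuous_on_closed_Collect_le continuous_on_subset[OF cont] closed_Times)
       (auto intro!: continuous_intros)
  moreover have "K \<subseteq> {0..T} \<times> {-R..R}" by (auto simp: K_def)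
  ultimately have "compact K"
    by (metis compact_Icc compact_Int_closed compact_Times inf.absorb2)
  moreover have "(t, x) \<in> K"
    using neg far[OF t, of x] t by (cases "R < \<bar>x\<bar>") (auto simp: K_def)
  ultimately have "\<exists>p\<in>K. \<forall>q\<in>K. fst p \<le> fst q"
    by (intro continuous_attains_inf) (auto intro!: continuous_intros)
  then obtain s y where sy: "(s, y) \<in> K" and min: "\<And>p. p \<in> K \<Longrightarrow> s \<le> fst p"
    by (metis prod.collapse)
  have s: "s \<in> {0..T}" and wsy: "w s y \<ge> 0" using sy by (auto simp: K_def)
  have "s \<noteq> 0" using wsy init[of y] by auto
  then have s0: "s > 0" using s by auto
  have before: "w \<tau> z < 0" if "\<tau> \<in> {0..<s}" for \<tau> z
  proof (rule ccontr)
    assume "\<not> w \<tau> z < 0"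
    then have "(\<tau>, z) \<in> K"
      using far[of \<tau> z] that s by (cases "R < \<bar>z\<bar>") (auto simp: K_def)
    from min[OF this] that show False by auto
  qed
  have at_s: "w s z \<le> 0" for z
  proof -
    have "continuous_on {0..T} (\<lambda>\<tau>. w (fst (\<tau>, z)) (snd (\<tau>, z)))"
      by (intro continuous_on_compose2[OF cont] continuous_intros) auto
    then have "((\<lambda>\<tau>. w \<tau> z) \<longlongrightarrow> w s z) (at s within {0..T})"
      using s by (simp add: continuous_on_def)
    then have "((\<lambda>\<tau>. w \<tau> z) \<longlongrightarrow> w s z) (at s within {0..<s})"
      by (rule tendsto_within_subset) (use s in auto)
    moreover have "eventually (\<lambda>\<tau>. w \<tau> z \<le> 0) (at s within {0..<s})"
      unfolding eventually_at_filter using before by (auto intro!: always_eventually less_imp_le)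
    moreover have "at s within {0..<s} \<noteq> bot"
      using s0 by (simp add: at_within_eq_bot_iff closure_atLeastLessThan)
    ultimately show ?thesis by (rule tendsto_upperbound)
  qed
  then have w0: "w s y = 0" using wsy by (simp add: order_antisym)
  obtain D where D: "(w s has_real_derivative D) (at y)" using diff[OF s] by blast
  have "D = 0"
    by (rule DERIV_local_max[OF D zero_less_one]) (use at_s w0 in auto)
  with D touch[OF s0 _ w0] s obtain D' where "D' < 0"
    and D': "((\<lambda>\<tau>. w \<tau> y) has_real_derivative D') (at s within {0..T})" by auto
  from has_real_derivative_neg_dec_left[OF D' this(1)] obtain d where "d > 0"
    and d: "\<And>h. 0 < h \<Longrightarrow> s - h \<in> {0..T} \<Longrightarrow> h < d \<Longrightarrow> w s y < w (s - h) y" by blast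
  define h where "h = min s (d / 2)"
  have "w s y < w (s - h) y" using s s0 \<open>d > 0\<close> by (intro d) (auto simp: h_def)
  moreover have "w (s - h) y < 0" using s s0 \<open>d > 0\<close> by (intro before) (auto simp: h_def)
  ultimately show False using w0 by simp
qed

section \<open>Convolution with the derivative of the Green function\<close>

text \<open>In the original variable, \<open>left_tail F x\<close> is \<open>e\<^sup>-\<^sup>x\<close> times the integral of \<open>e\<^sup>y F(y)\<close> over \<open>y < x\<close>. The form
  below makes bounds in exponential weights immediate; the other one is \<open>exp_mult_left_tail\<close>.\<close>
definition left_tail :: "(real \<Rightarrow> real) \<Rightarrow> real \<Rightarrow> real" where
  "left_tail F x = (LINT z|lborel. indicator {0..} z * exp (- z) * F (x - z))"

definition right_tail :: "(real \<Rightarrow> real) \<Rightarrow> real \<Rightarrow> real" where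
  "right_tail F x = left_tail (\<lambda>y. F (- y)) (- x)"

lemma has_bochner_integral_exp_half_line:
  fixes c :: real
  assumes "c > 0"
  shows "has_bochner_integral lborel (\<lambda>z. indicator {0..} z * exp (- (c * z))) (1 / c)"
proof (rule has_bochner_integral_nn_integral)
  have "((\<lambda>z. - exp (- (c * z)) / c) \<longlongrightarrow> - 0 / c) at_top"
  proof (intro tendsto_intros)
    have "filterlim (\<lambda>z. c * z) at_top at_top"
      using assms by (intro filterlim_tendsto_pos_mult_at_top[OF tendsto_const]) (auto simp: filterlim_ident)
    then show "((\<lambda>z. exp (- (c * z))) \<longlongrightarrow> 0) at_top"
      by (intro filterlim_compose[OF exp_at_bot]) (simp add: filterlim_uminus_at_top)
  qed (use assms in auto)
  then have "(\<integral>\<^sup>+z. ennreal (exp (- (c * z))) * indicator {0..} z \<partial>lborel) = ennreal (0 - (- exp (- (c * 0)) / c))"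
    using assms by (intro nn_integral_FTC_atLeast) (auto intro!: derivative_eq_intros)
  moreover have "(\<integral>\<^sup>+z. ennreal (exp (- (c * z))) * indicator {0..} z \<partial>lborel)
     = (\<integral>\<^sup>+z. ennreal (indicator {0..} z * exp (- (c * z))) \<partial>lborel)"
    by (intro nn_integral_cong) (auto simp: indicator_def)
  ultimately show "(\<integral>\<^sup>+z. ennreal (indicator {0..} z * exp (- (c * z))) \<partial>lborel) = ennreal (1 / c)"
    by simp
qed (use assms in auto)

text \<open>The growth rate \<open>\<beta> < 1\<close> is the one that the kernel \<open>e\<^sup>-\<^sup>z\<close> can absorb. With \<open>\<beta> = 0\<close> this is the sup
  bound, with \<open>\<beta> = \<alpha>\<close> the bound in the decay weights.\<close>
lemma left_tail_integrable_bound: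
  fixes F :: "real \<Rightarrow> real"
  assumes [measurable]: "F \<in> borel_measurable borel" and \<beta>: "\<beta> < 1"
    and F: "\<And>z. z \<ge> 0 \<Longrightarrow> \<bar>F (x - z)\<bar> \<le> B * exp (\<beta> * z)"
  shows "integrable lborel (\<lambda>z. indicator {0..} z * exp (- z) * F (x - z))"
    and "\<bar>left_tail F x\<bar> \<le> B / (1 - \<beta>)"
proof -
  let ?e = "\<lambda>z::real. B * (indicator {0..} z * exp (- ((1 - \<beta>) * z)))"
  have e: "has_bochner_integral lborel ?e (B * (1 / (1 - \<beta>)))"
    using \<beta> by (intro has_bochner_integral_mult_right has_bochner_integral_exp_half_line) auto
  then have ie: "integrable lborel ?e" by (simp add: has_bochner_integral_iff)
  have le: "norm (indicator {0..} z * exp (- z) * F (x - z)) \<le> ?e z" for z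
  proof (cases "z \<ge> 0")
    case True
    have "exp (- z) * \<bar>F (x - z)\<bar> \<le> exp (- z) * (B * exp (\<beta> * z))"
      using F[OF True] by simp
    also have "\<dots> = B * exp (- ((1 - \<beta>) * z))"
      by (simp add: exp_add[symmetric] mult.left_commute algebra_simps)
    finally show ?thesis using True by (simp add: abs_mult)
  qed simp
  show int: "integrable lborel (\<lambda>z. indicator {0..} z * exp (- z) * F (x - z))"
  proof (rule Bochner_Integration.integrable_bound[OF ie])
    show "AE z in lborel. norm (indicator {0..} z * exp (- z) * F (x - z)) \<le> norm (?e z)"
      using le by (intro AE_I2) (metis abs_ge_self order_trans real_norm_def)
  qed simp
  have "norm (left_tail F x) \<le> integral\<^sup>L lborel ?e"
    unfolding left_tail_def by (rule Bochner_Integration.integral_norm_bound_integral[OF int ie le])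
  also have "\<dots> = B / (1 - \<beta>)" using e by (simp add: has_bochner_integral_iff)
  finally show "\<bar>left_tail F x\<bar> \<le> B / (1 - \<beta>)" by simp
qed

lemma right_tail_bound:
  fixes F :: "real \<Rightarrow> real"
  assumes "F \<in> borel_measurable borel" and \<beta>: "\<beta> < 1"
    and F: "\<And>z. z \<ge> 0 \<Longrightarrow> \<bar>F (x + z)\<bar> \<le> B * exp (\<beta> * z)"
  shows "\<bar>right_tail F x\<bar> \<le> B / (1 - \<beta>)"
proof -
  note [measurable] = assms(1)
  show ?thesis unfolding right_tail_def
    by (rule left_tail_integrable_bound(2)[OF _ \<beta>]) (use F in \<open>auto simp: add.commute\<close>)
qed

lemma exp_mult_left_tail:
  "exp x * left_tail F x = (LINT y|lborel. indicator {..x} y * (exp y * F y))"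
proof -
  have "(LINT y|lborel. indicator {..x} y * (exp y * F y))
     = \<bar>-1\<bar> *\<^sub>R (LINT z|lborel. indicator {..x} (x + (-1) * z) * (exp (x + (-1) * z) * F (x + (-1) * z)))"
    by (rule lborel_integral_real_affine) simp
  also have "\<dots> = (LINT z|lborel. exp x * (indicator {0..} z * exp (- z) * F (x - z)))"
    unfolding abs_neg_one scaleR_one
    by (intro Bochner_Integration.integral_cong) (auto simp: indicator_def exp_diff exp_minus field_simps)
  finally show ?thesis by (simp add: left_tail_def)
qed

text \<open>The fundamental theorem of calculus for \<open>e\<^sup>x\<close> times the tail, based at \<open>x - 1\<close>.\<close>
lemma left_tail_derivative:
  fixes F :: "real \<Rightarrow> real"
  assumes cont: "continuous_on UNIV F" and bnd: "\<And>y. \<bar>F y\<bar> \<le> B"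
  shows "(left_tail F has_real_derivative F x - left_tail F x) (at x)"
proof -
  have [measurable]: "F \<in> borel_measurable borel"
    using cont by (rule borel_measurable_continuous_onI)
  define h where "h y = exp y * F y" for y
  have conth: "continuous_on S h" for S
    unfolding h_def by (intro continuous_intros continuous_on_subset[OF cont]) auto
  have int: "integrable lborel (\<lambda>y. indicator {..x} y * h y)" for x
  proof -
    have "integrable lborel (\<lambda>z. indicator {0..} z * exp (- z) * F (x - z))"
      by (rule left_tail_integrable_bound(1)[of F 0 _ B]) (use bnd in auto)
    then have "integrable lborel (\<lambda>z. exp x * (indicator {0..} z * exp (- z) * F (x - z)))" by simp
    also have "(\<lambda>z. exp x * (indicator {0..} z * exp (- z) * F (x - z))) = (\<lambda>z. indicator {..x} (x + (-1) * z) * h (x + (-1) * z))"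
      by (auto simp: indicator_def exp_diff exp_minus field_simps h_def fun_eq_iff)
    finally show ?thesis
      by (subst (asm) lborel_integrable_real_affine_iff) auto
  qed
  have split: "exp y * left_tail F y = exp (x - 1) * left_tail F (x - 1) + integral {x - 1..y} h" if "y \<ge> x - 1" for y
  proof -
    have si: "set_integrable lborel {x - 1..y} h"
      by (intro borel_integrable_atLeastAtMost' conth)
    have "exp y * left_tail F y = (LINT z|lborel. indicator {..x - 1} z * h z + indicator {x - 1..y} z * h z)"
      unfolding exp_mult_left_tail h_def[symmetric]
    proof (rule integral_cong_AE)
      show "AE z in lborel. indicator {..y} z * h z = indicator {..x - 1} z * h z + indicator {x - 1..y} z * h z"
        using AE_lborel_singleton[of "x - 1"] by eventually_elim (use that in \<open>auto simp: indicator_def\<close>)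
    qed (auto simp: h_def)
    also have "\<dots> = (LINT z|lborel. indicator {..x - 1} z * h z) + (LINT z|lborel. indicator {x - 1..y} z * h z)"
      using si by (intro Bochner_Integration.integral_add int) (simp add: set_integrable_def)
    also have "(LINT z|lborel. indicator {x - 1..y} z * h z) = integral {x - 1..y} h"
      using set_borel_integral_eq_integral(2)[OF si] by (simp add: set_lebesgue_integral_def)
    finally show ?thesis unfolding exp_mult_left_tail h_def[symmetric] .
  qed
  have "((\<lambda>y. integral {x - 1..y} h) has_real_derivative h x) (at x within {x - 1..x + 1})"
    by (rule integral_has_real_derivative[OF conth]) auto
  then have "((\<lambda>y. integral {x - 1..y} h) has_real_derivative h x) (at x)"
    by (simp add: at_within_Icc_at)
  then have "((\<lambda>y. exp (- y) * (exp (x - 1) * left_tail F (x - 1) + integral {x - 1..y} h)) has_real_derivative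
      exp (- x) * h x - exp (- x) * (exp (x - 1) * left_tail F (x - 1) + integral {x - 1..x} h)) (at x)"
    by (auto intro!: derivative_eq_intros simp: algebra_simps)
  also have "exp (- x) * h x - exp (- x) * (exp (x - 1) * left_tail F (x - 1) + integral {x - 1..x} h) = F x - left_tail F x"
    using split[of x] by (simp add: h_def exp_minus field_simps)
  finally show ?thesis
  proof (rule has_field_derivative_transform_within_open)
    show "open {x - 1<..}" "x \<in> {x - 1<..}" by auto
    show "exp (- y) * (exp (x - 1) * left_tail F (x - 1) + integral {x - 1..y} h) = left_tail F y" if "y \<in> {x - 1<..}" for y
      using split[of y] that by (simp add: exp_minus field_simps)
  qed
qed

lemma right_tail_derivative:
  fixes F :: "real \<Rightarrow> real"
  assumes cont: "continuous_on UNIV F" and bnd: "\<And>y. \<bar>F y\<bar> \<le> B"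
  shows "(right_tail F has_real_derivative right_tail F x - F x) (at x)"
proof -
  have "continuous_on UNIV (\<lambda>y. F (- y))"
    by (intro continuous_on_compose2[OF cont] continuous_intros) auto
  from left_tail_derivative[OF this bnd, of "- x"]
  have "(left_tail (\<lambda>y. F (- y)) has_real_derivative F x - right_tail F x) (at (- x))"
    by (simp add: right_tail_def)
  from DERIV_chain2[where g = uminus and x = x and s = UNIV and Db = "-1", OF this]
  have "((\<lambda>x. left_tail (\<lambda>y. F (- y)) (- x)) has_real_derivative (F x - right_tail F x) * - 1) (at x)"
    using DERIV_mirror[of "\<lambda>y. y" 1 x] by (auto intro!: derivative_eq_intros)
  then show ?thesis by (simp add: right_tail_def[abs_def])
qed

text \<open>The derivative of \<open>G\<close> is \<open>e\<^sup>z/2\<close> on the negative and \<open>- e\<^sup>-\<^sup>z/2\<close> on the positive half-line; the two halves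
  of the convolution integral are the two tails.\<close>
lemma convolution_deriv_G:
  fixes F :: "real \<Rightarrow> real"
  assumes [measurable]: "F \<in> borel_measurable borel" and bnd: "\<And>y. \<bar>F y\<bar> \<le> B"
  shows "Defs.convolution (deriv G) F x = (right_tail F x - left_tail F x) / 2"
proof -
  have dG: "deriv G z = - exp (- z) / 2" if "z > 0" for z
  proof (rule DERIV_imp_deriv, rule has_field_derivative_transform_within_open[where S = "{0<..}"])
    show "((\<lambda>z. exp (- z) / 2) has_real_derivative - exp (- z) / 2) (at z)"
      by (auto intro!: derivative_eq_intros)
  qed (use that in \<open>auto simp: G_def\<close>)
  have dG': "deriv G z = exp z / 2" if "z < 0" for z
  proof (rule DERIV_imp_deriv, rule has_field_derivative_transform_within_open[where S = "{..<0}"])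
    show "((\<lambda>z. exp z / 2) has_real_derivative exp z / 2) (at z)"
      by (auto intro!: derivative_eq_intros)
  qed (use that in \<open>auto simp: G_def\<close>)
  define p where "p z = indicator {0..} z * exp (- z) * F (x - z)" for z :: real
  define q where "q z = indicator {0..} z * exp (- z) * F (x + z)" for z :: real
  have [measurable]: "p \<in> borel_measurable borel" "q \<in> borel_measurable borel"
    unfolding p_def q_def by measurable
  have p: "integrable lborel p"
    unfolding p_def by (rule left_tail_integrable_bound(1)[of F 0 _ B]) (use bnd in auto)
  have "integrable lborel (\<lambda>z. indicator {0..} z * exp (- z) * F (- (- x - z)))"
    by (rule left_tail_integrable_bound(1)[of "\<lambda>y. F (- y)" 0 _ B]) (use bnd in auto)
  then have q: "integrable lborel q" by (simp add: q_def[abs_def] add.commute)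
  have q': "integrable lborel (\<lambda>z. q (- z))" "(LINT z|lborel. q (- z)) = (LINT z|lborel. q z)"
    using lborel_integrable_real_affine[OF q, of "-1" 0] lborel_integral_real_affine[of "-1" q 0] by simp_all
  have AE: "AE z in lborel. deriv G z * F (x - z) = (q (- z) - p z) / 2"
    using AE_lborel_singleton[of "0::real"]
  proof eventually_elim
    case (elim z)
    then show ?case by (cases "z > 0") (auto simp: dG dG' p_def q_def)
  qed
  have "(\<lambda>z. if z > 0 then - exp (- z) / 2 else if z < 0 then exp z / 2 else deriv G 0) \<in> borel_measurable borel"
    by measurable
  also have "(\<lambda>z. if z > 0 then - exp (- z) / 2 else if z < 0 then exp z / 2 else deriv G 0) = deriv G"
    by (auto simp: dG dG' fun_eq_iff not_less order.antisym)
  finally have [measurable]: "deriv G \<in> borel_measurable borel" .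
  have "Defs.convolution (deriv G) F x = \<bar>-1\<bar> *\<^sub>R (LINT z|lborel. deriv G (x - (x + (-1) * z)) * F (x + (-1) * z))"
    unfolding Defs.convolution_def by (rule lborel_integral_real_affine) simp
  also have "\<dots> = (LINT z|lborel. deriv G z * F (x - z))" by simp
  also have "\<dots> = (LINT z|lborel. (q (- z) - p z) / 2)"
    by (rule integral_cong_AE) (use AE in auto)
  also have "\<dots> = ((LINT z|lborel. q z) - (LINT z|lborel. p z)) / 2"
    using p q' by simp
  also have "(LINT z|lborel. q z) = right_tail F x"
    by (simp add: q_def right_tail_def left_tail_def add.commute)
  also have "(LINT z|lborel. p z) = left_tail F x"
    by (simp add: p_def left_tail_def)
  finally show ?thesis .
qed

section \<open>Weights with two-sided exponential growth\<close>

text \<open>The first term is the decay to be proved. The second makes the weight tend to infinity at both ends and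
  bounds it away from zero, at a price that vanishes with \<open>\<epsilon>\<close>.\<close>
definition decay_weight :: "real \<Rightarrow> real \<Rightarrow> real \<Rightarrow> real" where
  "decay_weight \<alpha> \<epsilon> x = exp (- (\<alpha> * x)) + \<epsilon> * exp (\<alpha> * x)"

lemma decay_weight_pos: "\<epsilon> \<ge> 0 \<Longrightarrow> decay_weight \<alpha> \<epsilon> x > 0"
  by (simp add: decay_weight_def add_pos_nonneg)

text \<open>Slow variation: this is what convolution with \<open>e\<^sup>-\<^sup>|\<^sup>z\<^sup>|\<close> needs in order to act boundedly in the weight.\<close>
lemma decay_weight_translate:
  assumes "\<epsilon> \<ge> 0" "\<alpha> \<ge> 0" "\<bar>y - x\<bar> \<le> d"
  shows "decay_weight \<alpha> \<epsilon> y \<le> exp (\<alpha> * d) * decay_weight \<alpha> \<epsilon> x"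
proof -
  have ad: "\<alpha> * \<bar>y - x\<bar> \<le> \<alpha> * d" using assms by (intro mult_left_mono)
  have "\<alpha> * (x - y) \<le> \<alpha> * \<bar>y - x\<bar>" "\<alpha> * (y - x) \<le> \<alpha> * \<bar>y - x\<bar>"
    using assms by (auto intro!: mult_left_mono)
  with ad have "exp (- (\<alpha> * y)) \<le> exp (\<alpha> * d) * exp (- (\<alpha> * x))" "exp (\<alpha> * y) \<le> exp (\<alpha> * d) * exp (\<alpha> * x)"
    unfolding exp_add[symmetric] by (auto simp: algebra_simps)
  then have "exp (- (\<alpha> * y)) + \<epsilon> * exp (\<alpha> * y) \<le> exp (\<alpha> * d) * exp (- (\<alpha> * x)) + \<epsilon> * (exp (\<alpha> * d) * exp (\<alpha> * x))"
    using assms by (intro add_mono mult_left_mono)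
  then show ?thesis by (simp add: decay_weight_def algebra_simps)
qed

lemma decay_weight_derivative:
  assumes "\<epsilon> \<ge> 0" "0 \<le> \<alpha>" "\<alpha> \<le> 1"
  obtains D where "(decay_weight \<alpha> \<epsilon> has_real_derivative D) (at x)" "\<bar>D\<bar> \<le> decay_weight \<alpha> \<epsilon> x"
proof
  let ?D = "\<alpha> * (\<epsilon> * exp (\<alpha> * x) - exp (- (\<alpha> * x)))"
  show "(decay_weight \<alpha> \<epsilon> has_real_derivative ?D) (at x)"
    unfolding decay_weight_def[abs_def] by (auto intro!: derivative_eq_intros simp: algebra_simps)
  have "\<bar>?D\<bar> = \<alpha> * \<bar>\<epsilon> * exp (\<alpha> * x) - exp (- (\<alpha> * x))\<bar>" using assms by (simp add: abs_mult)
  also have "\<dots> \<le> 1 * \<bar>\<epsilon> * exp (\<alpha> * x) - exp (- (\<alpha> * x))\<bar>" using assms by (intro mult_right_mono) auto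
  also have "\<dots> \<le> decay_weight \<alpha> \<epsilon> x" using assms by (simp add: decay_weight_def abs_le_iff)
  finally show "\<bar>?D\<bar> \<le> decay_weight \<alpha> \<epsilon> x" .
qed

lemma decay_weight_coercive:
  assumes "\<epsilon> > 0" "\<alpha> > 0"
  obtains R where "\<And>x. R < \<bar>x\<bar> \<Longrightarrow> K < decay_weight \<alpha> \<epsilon> x"
proof
  fix x :: real
  assume x: "(\<bar>K\<bar> + \<bar>K\<bar> / \<epsilon>) / \<alpha> < \<bar>x\<bar>"
  then have ax: "\<bar>K\<bar> + \<bar>K\<bar> / \<epsilon> < \<alpha> * \<bar>x\<bar>" using assms by (simp add: field_simps)
  have e: "\<alpha> * \<bar>x\<bar> < exp (\<alpha> * \<bar>x\<bar>)" using exp_ge_add_one_self[of "\<alpha> * \<bar>x\<bar>"] by linarith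
  have K: "\<bar>K\<bar> / \<epsilon> \<ge> 0" using assms by simp
  show "K < decay_weight \<alpha> \<epsilon> x"
  proof (cases "x \<ge> 0")
    case True
    have "\<bar>K\<bar> / \<epsilon> < exp (\<alpha> * x)" using ax e True by simp
    then have "\<bar>K\<bar> < \<epsilon> * exp (\<alpha> * x)" using assms by (simp add: field_simps)
    then show ?thesis using exp_gt_zero[of "- (\<alpha> * x)"] unfolding decay_weight_def by linarith
  next
    case False
    have "\<bar>K\<bar> < exp (- (\<alpha> * x))" using ax e K False by simp
    moreover have "\<epsilon> * exp (\<alpha> * x) \<ge> 0" using assms by simp
    ultimately show ?thesis unfolding decay_weight_def by linarith
  qed
qed

lemma decay_weight_lower_bound: "\<epsilon> \<ge> 0 \<Longrightarrow> decay_weight \<alpha> \<epsilon> x \<ge> min 1 \<epsilon>"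
proof -
  assume e: "\<epsilon> \<ge> 0"
  show ?thesis
  proof (cases "\<alpha> * x \<le> 0")
    case True
    then have "1 \<le> exp (- (\<alpha> * x))" by simp
    moreover have "\<epsilon> * exp (\<alpha> * x) \<ge> 0" using e by simp
    ultimately show ?thesis unfolding decay_weight_def by linarith
  next
    case False
    then have "\<epsilon> * 1 \<le> \<epsilon> * exp (\<alpha> * x)" using e by (intro mult_left_mono) auto
    then show ?thesis using exp_gt_zero[of "- (\<alpha> * x)"] unfolding decay_weight_def by linarith
  qed
qed

section \<open>Classical solutions\<close>

text \<open>The part of the information carried by a strong solution on which the decay arguments rest. The
  convolution is written out through the two tails, and the functions are controlled in the sup norm only.\<close>
locale classical_CH_solution =
  fixes T M :: real and u ux :: "real \<Rightarrow> real \<Rightarrow> real"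
  assumes T: "T > 0"
    and ux: "\<And>t x. t \<in> {0..T} \<Longrightarrow> (u t has_real_derivative ux t x) (at x)"
    and ux_continuous: "\<And>t. t \<in> {0..T} \<Longrightarrow> continuous_on UNIV (ux t)"
    and u_le: "\<And>t x. t \<in> {0..T} \<Longrightarrow> \<bar>u t x\<bar> \<le> M"
    and ux_le: "\<And>t x. t \<in> {0..T} \<Longrightarrow> \<bar>ux t x\<bar> \<le> M"
    and equation: "\<And>t x. t \<in> {0..T} \<Longrightarrow> ((\<lambda>\<tau>. u \<tau> x) has_real_derivative
        - (u t x * ux t x) - (right_tail (\<lambda>y. (u t y)\<^sup>2 + 1/2 * (ux t y)\<^sup>2) x
          - left_tail (\<lambda>y. (u t y)\<^sup>2 + 1/2 * (ux t y)\<^sup>2) x) / 2) (at t within {0..T})"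
    and time_continuous: "\<And>t e. t \<in> {0..T} \<Longrightarrow> e > 0 \<Longrightarrow> \<exists>d>0. \<forall>\<tau>\<in>{0..T}. \<bar>\<tau> - t\<bar> < d \<longrightarrow>
        (\<forall>x. \<bar>u \<tau> x - u t x\<bar> \<le> e \<and> \<bar>ux \<tau> x - ux t x\<bar> \<le> e)"
begin

definition F :: "real \<Rightarrow> real \<Rightarrow> real" where
  "F t y = (u t y)\<^sup>2 + 1/2 * (ux t y)\<^sup>2"

definition Px :: "real \<Rightarrow> real \<Rightarrow> real" where
  "Px t x = (right_tail (F t) x - left_tail (F t) x) / 2"

definition ut :: "real \<Rightarrow> real \<Rightarrow> real" where
  "ut t x = - (u t x * ux t x) - Px t x"

lemma u_time_derivative:
  "t \<in> {0..T} \<Longrightarrow> ((\<lambda>\<tau>. u \<tau> x) has_real_derivative ut t x) (at t within {0..T})"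
  using equation[of t x] by (simp add: ut_def Px_def F_def[abs_def])

lemma M_nonneg: "M \<ge> 0"
  using u_le[of 0 0] T by auto

lemma u_continuous: "t \<in> {0..T} \<Longrightarrow> continuous_on UNIV (u t)"
  using ux by (meson DERIV_continuous_on has_field_derivative_at_within)

lemma F_continuous: "t \<in> {0..T} \<Longrightarrow> continuous_on UNIV (F t)"
  unfolding F_def[abs_def] by (intro continuous_intros u_continuous ux_continuous)

lemma F_measurable: "t \<in> {0..T} \<Longrightarrow> F t \<in> borel_measurable borel"
  by (intro borel_measurable_continuous_onI F_continuous)

lemma F_nonneg: "F t x \<ge> 0"
  by (simp add: F_def)

text \<open>Bounding one factor of each square by \<open>M\<close> makes the nonlinearity linear in the weighted size.\<close>
lemma F_le_linear:
  assumes "t \<in> {0..T}" "\<bar>u t x\<bar> \<le> k" "\<bar>ux t x\<bar> \<le> k"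
  shows "\<bar>F t x\<bar> \<le> 3/2 * M * k"
proof -
  have "\<bar>u t x\<bar> * \<bar>u t x\<bar> \<le> M * k"
    using assms M_nonneg by (intro mult_mono u_le) auto
  moreover have "\<bar>ux t x\<bar> * \<bar>ux t x\<bar> \<le> M * k"
    using assms M_nonneg by (intro mult_mono ux_le) auto
  ultimately show ?thesis by (simp add: F_def power2_eq_square)
qed

lemma F_le: "t \<in> {0..T} \<Longrightarrow> \<bar>F t x\<bar> \<le> 3/2 * M * M"
  using F_le_linear[OF _ u_le ux_le] by blast

lemma Px_derivative:
  assumes t: "t \<in> {0..T}"
  shows "(Px t has_real_derivative (right_tail (F t) x + left_tail (F t) x) / 2 - F t x) (at x)"
proof -
  have "((\<lambda>x. (right_tail (F t) x - left_tail (F t) x) / 2) has_real_derivative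
      ((right_tail (F t) x - F t x) - (F t x - left_tail (F t) x)) / 2) (at x)"
    by (intro DERIV_cdivide DERIV_diff right_tail_derivative[OF F_continuous[OF t] F_le[OF t]]
      left_tail_derivative[OF F_continuous[OF t] F_le[OF t]])
  then show ?thesis unfolding Px_def[abs_def] by (simp add: field_simps)
qed

lemma jointly_continuous: "continuous_on ({0..T} \<times> UNIV) (\<lambda>p. u (fst p) (snd p))"
  unfolding continuous_on_iff
proof (intro ballI allI impI)
  fix p :: "real \<times> real" and e :: real
  assume p: "p \<in> {0..T} \<times> UNIV" and e: "e > 0"
  obtain t x where tx: "p = (t, x)" by (cases p)
  have t: "t \<in> {0..T}" using p tx by auto
  obtain d where d: "d > 0" "\<And>\<tau> x. \<tau> \<in> {0..T} \<Longrightarrow> \<bar>\<tau> - t\<bar> < d \<Longrightarrow> \<bar>u \<tau> x - u t x\<bar> \<le> e / 2"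
    using time_continuous[OF t, of "e / 2"] e by auto
  have "isCont (u t) x" using u_continuous[OF t] by (simp add: continuous_on_eq_continuous_at)
  then obtain d' where d': "d' > 0" "\<And>y. \<bar>y - x\<bar> < d' \<Longrightarrow> \<bar>u t y - u t x\<bar> < e / 2"
    using e unfolding continuous_at_eps_delta by (metis dist_real_def half_gt_zero)
  show "\<exists>d>0. \<forall>q\<in>{0..T} \<times> UNIV. dist q p < d \<longrightarrow> dist (u (fst q) (snd q)) (u (fst p) (snd p)) < e"
  proof (intro exI[of _ "min d d'"] conjI ballI impI)
    show "min d d' > 0" using d d' by simp
    fix q :: "real \<times> real" assume q: "q \<in> {0..T} \<times> UNIV" "dist q p < min d d'"
    obtain s y where sy: "q = (s, y)" by (cases q)
    have "\<bar>s - t\<bar> < d" "\<bar>y - x\<bar> < d'"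
      using q(2) dist_fst_le[of q p] dist_snd_le[of q p] by (auto simp: sy tx dist_real_def)
    then have "\<bar>u s y - u t y\<bar> \<le> e / 2" "\<bar>u t y - u t x\<bar> < e / 2" using d d' q sy by auto
    then show "dist (u (fst q) (snd q)) (u (fst p) (snd p)) < e"
      unfolding sy tx dist_real_def fst_conv snd_conv by linarith
  qed
qed

end

section \<open>Persistence of exponential decay\<close>

text \<open>A multiple of the weight dominates the initial datum and its derivative. The final
  bound \<open>dominated_2A\<close> does not involve \<open>\<epsilon>\<close> except through the weight.\<close>
locale weighted_CH_solution = classical_CH_solution +
  fixes \<alpha> \<epsilon> A :: real
  assumes \<alpha>: "0 < \<alpha>" "\<alpha> < 1" and \<epsilon>: "\<epsilon> > 0" and A: "A \<ge> 0"
    and initial: "\<And>x. \<bar>u 0 x\<bar> \<le> A * decay_weight \<alpha> \<epsilon> x" "\<And>x. \<bar>ux 0 x\<bar> \<le> A * decay_weight \<alpha> \<epsilon> x"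
begin

abbreviation \<psi> :: "real \<Rightarrow> real" where "\<psi> \<equiv> decay_weight \<alpha> \<epsilon>"

text \<open>Bounds the norm of the tail operators in the weight.\<close>
definition c :: real where "c = 1 / (1 - \<alpha>)"

text \<open>Large enough to absorb the transport terms (\<open>2 M\<close>) and the nonlocal terms (\<open>6 c M\<close>, twice their size,
  because the latter are measured against \<open>L\<close> and the barrier only contains \<open>L/2\<close>).\<close>
definition rate :: real where "rate = 2 * M + 6 * c * M + 1"

definition dominated :: "real \<Rightarrow> bool" where
  "dominated L \<longleftrightarrow> (\<forall>t\<in>{0..T}. \<forall>x. \<bar>u t x\<bar> \<le> L * exp (rate * t) * \<psi> x \<and> \<bar>ux t x\<bar> \<le> L * exp (rate * t) * \<psi> x)"

lemma \<psi>_pos: "\<psi> x > 0"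
  using decay_weight_pos[of \<epsilon> \<alpha> x] \<epsilon> by simp

lemma c_ge_1: "c \<ge> 1"
  using \<alpha> by (simp add: c_def)

lemma rate_pos: "rate > 0"
  using M_nonneg c_ge_1 by (simp add: rate_def add_nonneg_pos)

lemma dominated_nonneg:
  assumes "dominated L"
  shows "L \<ge> 0"
proof -
  have "\<bar>u 0 0\<bar> \<le> L * exp (rate * 0) * \<psi> 0"
    using assms T unfolding dominated_def by (metis atLeastAtMost_iff less_imp_le order_refl)
  then have "0 \<le> L * \<psi> 0" using abs_ge_zero[of "u 0 0"] by simp
  then show ?thesis using \<psi>_pos[of 0] by (simp add: zero_le_mult_iff)
qed

lemma abs_half_diff_le: "\<bar>a\<bar> \<le> k \<Longrightarrow> \<bar>b\<bar> \<le> k \<Longrightarrow> \<bar>(b - a) / 2\<bar> \<le> k"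
  for a b k :: real
  by (auto simp: abs_le_iff)

lemma abs_half_sum_diff_le:
  "\<bar>a\<bar> \<le> k \<Longrightarrow> \<bar>b\<bar> \<le> k \<Longrightarrow> \<bar>f\<bar> \<le> l \<Longrightarrow> \<bar>(b + a) / 2 - f\<bar> \<le> k + l"
  for a b f k l :: real
  by (auto simp: abs_le_iff field_simps)

lemma tails_bound:
  assumes "dominated L" "t \<in> {0..T}"
  shows "\<bar>F t x\<bar> \<le> 3/2 * M * (L * exp (rate * t) * \<psi> x)"
    and "\<bar>left_tail (F t) x\<bar> \<le> c * (3/2 * M * (L * exp (rate * t) * \<psi> x))"
    and "\<bar>right_tail (F t) x\<bar> \<le> c * (3/2 * M * (L * exp (rate * t) * \<psi> x))"
proof -
  have F: "\<bar>F t y\<bar> \<le> 3/2 * M * (L * exp (rate * t) * \<psi> y)" for y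
    using assms by (intro F_le_linear) (auto simp: dominated_def)
  then show "\<bar>F t x\<bar> \<le> 3/2 * M * (L * exp (rate * t) * \<psi> x)" .
  note L = dominated_nonneg[OF assms(1)]
  have F': "\<bar>F t y\<bar> \<le> 3/2 * M * (L * exp (rate * t) * \<psi> x) * exp (\<alpha> * z)" if "\<bar>y - x\<bar> \<le> z" for y z
  proof -
    have "\<psi> y \<le> exp (\<alpha> * z) * \<psi> x" using decay_weight_translate[OF _ _ that] \<alpha> \<epsilon> by simp
    then have "3/2 * M * (L * exp (rate * t) * \<psi> y) \<le> 3/2 * M * (L * exp (rate * t) * (exp (\<alpha> * z) * \<psi> x))"
      using M_nonneg L by (intro mult_left_mono) auto
    with F[of y] show ?thesis by (simp add: mult_ac)
  qed
  show "\<bar>left_tail (F t) x\<bar> \<le> c * (3/2 * M * (L * exp (rate * t) * \<psi> x))"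
  proof -
    have "\<bar>left_tail (F t) x\<bar> \<le> 3/2 * M * (L * exp (rate * t) * \<psi> x) / (1 - \<alpha>)"
      by (rule left_tail_integrable_bound(2)[OF F_measurable[OF assms(2)] \<alpha>(2)]) (rule F', simp)
    then show ?thesis by (simp only: c_def times_divide_eq_left mult_1)
  qed
  show "\<bar>right_tail (F t) x\<bar> \<le> c * (3/2 * M * (L * exp (rate * t) * \<psi> x))"
  proof -
    have "\<bar>right_tail (F t) x\<bar> \<le> 3/2 * M * (L * exp (rate * t) * \<psi> x) / (1 - \<alpha>)"
      by (rule right_tail_bound[OF F_measurable[OF assms(2)] \<alpha>(2)]) (rule F', simp)
    then show ?thesis by (simp only: c_def times_divide_eq_left mult_1)
  qed
qed

text \<open>The first half of the contraction: integrate the equation in time, treating the transport term \<open>u u\<^sub>x\<close> as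
  a perturbation of size \<open>M L\<close>.\<close>
lemma dominated_u_improve:
  assumes dom: "dominated L" and t: "t \<in> {0..T}"
  shows "\<bar>u t x\<bar> \<le> (A + L / 2) * exp (rate * t) * \<psi> x"
proof -
  note L = dominated_nonneg[OF dom]
  define g where "g \<sigma> \<tau> = (A + L / 2) * exp (rate * \<tau>) * \<psi> x - \<sigma> * u \<tau> x" for \<sigma> \<tau>
  have "g \<sigma> 0 \<le> g \<sigma> t" if \<sigma>: "\<sigma> = 1 \<or> \<sigma> = -1" for \<sigma>
  proof (rule DERIV_nonneg_imp_increasing_open[where f = "g \<sigma>"])
    have D: "(g \<sigma> has_real_derivative (A + L / 2) * (rate * exp (rate * \<tau>)) * \<psi> x - \<sigma> * ut \<tau> x) (at \<tau> within {0..T})"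
      if "\<tau> \<in> {0..T}" for \<tau>
      unfolding g_def[abs_def] using u_time_derivative[OF that, of x]
      by (auto intro!: derivative_eq_intros simp: algebra_simps)
    then have "continuous_on {0..T} (g \<sigma>)" by (rule DERIV_continuous_on)
    then show "continuous_on {0..t} (g \<sigma>)" by (rule continuous_on_subset) (use t in auto)
    fix \<tau> assume \<tau>: "0 < \<tau>" "\<tau> < t"
    then have \<tau>': "\<tau> \<in> {0..T}" using t by auto
    define E where "E = L * exp (rate * \<tau>) * \<psi> x"
    have E: "E \<ge> 0" using L \<psi>_pos[of x] by (simp add: E_def)
    have "\<bar>u \<tau> x * ux \<tau> x\<bar> \<le> M * E"
      unfolding abs_mult using u_le[OF \<tau>', of x] dom \<tau>' M_nonneg by (intro mult_mono) (auto simp: dominated_def E_def)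
    moreover have "\<bar>Px \<tau> x\<bar> \<le> c * (3/2 * M * E)"
      using tails_bound(2,3)[OF dom \<tau>', of x] unfolding Px_def E_def[symmetric] by (rule abs_half_diff_le)
    ultimately have "\<bar>ut \<tau> x\<bar> \<le> M * E + c * (3/2 * M * E)"
      unfolding ut_def by linarith
    also have "\<dots> \<le> rate / 2 * E"
    proof -
      have "0 \<le> c * M * E" using E c_ge_1 M_nonneg by simp
      then show ?thesis using E by (simp add: rate_def algebra_simps)
    qed
    also have "\<dots> \<le> (A + L / 2) * (rate * exp (rate * \<tau>)) * \<psi> x"
    proof -
      have "0 \<le> A * (rate * exp (rate * \<tau>)) * \<psi> x"
        using A rate_pos \<psi>_pos[of x] by (simp add: less_imp_le)
      then show ?thesis by (simp add: E_def algebra_simps)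
    qed
    finally have "(A + L / 2) * (rate * exp (rate * \<tau>)) * \<psi> x - \<sigma> * ut \<tau> x \<ge> 0"
      using \<sigma> by (auto simp: abs_le_iff)
    moreover have "(g \<sigma> has_real_derivative (A + L / 2) * (rate * exp (rate * \<tau>)) * \<psi> x - \<sigma> * ut \<tau> x) (at \<tau>)"
      using D[OF \<tau>'] \<tau> t by (simp add: at_within_Icc_at)
    ultimately show "\<exists>y. (g \<sigma> has_real_derivative y) (at \<tau>) \<and> 0 \<le> y" by blast
  qed (use t in auto)
  moreover have "g \<sigma> 0 \<ge> 0" if "\<sigma> = 1 \<or> \<sigma> = -1" for \<sigma>
  proof -
    have "\<sigma> * u 0 x \<le> \<bar>u 0 x\<bar>" using that by auto
    also have "\<dots> \<le> A * \<psi> x" by (rule initial)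
    also have "\<dots> \<le> (A + L / 2) * \<psi> x" using L \<psi>_pos[of x] by (intro mult_right_mono) auto
    finally show ?thesis by (simp add: g_def)
  qed
  ultimately have "g \<sigma> t \<ge> 0" if "\<sigma> = 1 \<or> \<sigma> = -1" for \<sigma>
  proof -
    note \<open>\<And>\<sigma>. \<sigma> = 1 \<or> \<sigma> = -1 \<Longrightarrow> 0 \<le> g \<sigma> 0\<close>[OF that]
    also note \<open>\<And>\<sigma>. \<sigma> = 1 \<or> \<sigma> = -1 \<Longrightarrow> g \<sigma> 0 \<le> g \<sigma> t\<close>[OF that]
    finally show ?thesis .
  qed
  from this[of 1] this[of "-1"] have "g 1 t \<ge> 0" "g (-1) t \<ge> 0" by simp_all
  then show ?thesis by (simp add: g_def abs_le_iff)
qed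

text \<open>The second half. At a first contact of the increment with the barrier its value and its slope are those
  of the barrier; then the transport term is at most \<open>2 M\<close> times the barrier, and the increment of the
  nonlocal term is at most \<open>h\<close> times the size of its derivative \<open>(r + l)/2 - F\<close>. The barrier grows faster than
  both together. The constant \<open>\<delta>\<close> makes the initial inequality strict.\<close>
lemma dominated_increment:
  assumes dom: "dominated L" and t: "t \<in> {0..T}" and h: "h > 0" and \<delta>: "\<delta> > 0"
  shows "\<bar>u t (x + h) - u t x\<bar> \<le> h * ((A + L / 2 + \<delta>) * exp (\<alpha> * h) * exp (rate * t) * \<psi> x)"
proof -
  note L = dominated_nonneg[OF dom]
  define b where "b = (A + L / 2 + \<delta>) * exp (\<alpha> * h)"
  have b: "b > 0" using A L \<delta> by (simp add: b_def)
  define w where "w \<sigma> t x = \<sigma> * (u t (x + h) - u t x) - h * b * exp (rate * t) * \<psi> x" for \<sigma> t x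
  have "\<exists>D. (\<psi> has_real_derivative D) (at x) \<and> \<bar>D\<bar> \<le> \<psi> x" for x
    by (rule decay_weight_derivative[of \<epsilon> \<alpha> x]) (use \<alpha> \<epsilon> in auto)
  then obtain \<psi>' where \<psi>': "\<And>x. (\<psi> has_real_derivative \<psi>' x) (at x)" "\<And>x. \<bar>\<psi>' x\<bar> \<le> \<psi> x"
    by metis
  have w: "w \<sigma> t x < 0" if \<sigma>: "\<sigma> = 1 \<or> \<sigma> = -1" for \<sigma>
  proof -
    have abs\<sigma>: "\<bar>\<sigma> * a\<bar> = \<bar>a\<bar>" for a using \<sigma> by auto
    obtain R where R: "\<And>x. R < \<bar>x\<bar> \<Longrightarrow> 2 * M / (h * b) < \<psi> x"
      using decay_weight_coercive[OF \<epsilon> \<alpha>(1)] by blast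
    show ?thesis
    proof (rule negative_by_first_contact[where w = "w \<sigma>" and T = T and R = R])
      show "t \<in> {0..T}" by (rule t)
    next
      have \<psi>c: "continuous_on UNIV \<psi>" using \<psi>'(1) by (meson DERIV_continuous_on has_field_derivative_at_within)
      have "continuous_on ({0..T} \<times> UNIV) (\<lambda>p. u (fst (fst p, snd p + h)) (snd (fst p, snd p + h)))"
        by (intro continuous_on_compose2[OF jointly_continuous, of _ "\<lambda>p. (fst p, snd p + h)"] continuous_intros) auto
      then show "continuous_on ({0..T} \<times> UNIV) (\<lambda>p. w \<sigma> (fst p) (snd p))"
        unfolding w_def
        by (intro continuous_intros jointly_continuous continuous_on_compose2[OF \<psi>c]) auto
    next
      fix x
      have 0: "0 \<in> {0..T}" using T by auto
      have "\<exists>z. x < z \<and> z < x + h \<and> u 0 (x + h) - u 0 x = (x + h - x) * ux 0 z"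
        using h ux[OF 0] by (intro MVT2) auto
      then obtain z where z: "x < z" "z < x + h" "u 0 (x + h) - u 0 x = h * ux 0 z" by auto
      have "\<bar>ux 0 z\<bar> \<le> A * \<psi> z" by (rule initial)
      also have "\<dots> \<le> A * (exp (\<alpha> * h) * \<psi> x)"
        using z \<alpha> \<epsilon> A by (intro mult_left_mono decay_weight_translate) auto
      also have "\<dots> < b * \<psi> x"
        unfolding b_def mult.assoc using \<psi>_pos[of x] L \<delta> by (intro mult_strict_right_mono) auto
      finally have "h * \<bar>ux 0 z\<bar> < h * (b * \<psi> x)" using h by simp
      moreover have "\<sigma> * (u 0 (x + h) - u 0 x) \<le> h * \<bar>ux 0 z\<bar>"
        using abs_ge_self[of "\<sigma> * (h * ux 0 z)"] h unfolding z(3) abs\<sigma> by (simp add: abs_mult)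
      ultimately show "w \<sigma> 0 x < 0" by (simp add: w_def)
    next
      fix t x assume t: "t \<in> {0..T}" and x: "R < \<bar>x\<bar>"
      have "\<sigma> * (u t (x + h) - u t x) \<le> 2 * M"
        using u_le[OF t, of x] u_le[OF t, of "x + h"] \<sigma> by (auto simp: abs_le_iff)
      also have "\<dots> < h * b * \<psi> x" using R[OF x] h b by (simp add: field_simps)
      also have "\<dots> \<le> h * b * \<psi> x * exp (rate * t)"
        using h b \<psi>_pos[of x] rate_pos t mult_left_mono[of 1 "exp (rate * t)" "h * b * \<psi> x"] by simp
      finally show "w \<sigma> t x < 0" by (simp add: w_def mult_ac)
    next
      fix t x assume t: "t \<in> {0..T}"
      have "((\<lambda>x. u t (x + h)) has_real_derivative ux t (x + h)) (at x)"
        using ux[OF t, of "x + h"] by (simp add: DERIV_shift)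
      then have "(w \<sigma> t has_real_derivative \<sigma> * (ux t (x + h) - ux t x) - h * b * exp (rate * t) * \<psi>' x) (at x)"
        unfolding w_def[abs_def] using ux[OF t, of x] \<psi>'(1)[of x] by (auto intro!: derivative_eq_intros)
      then show "\<exists>D. (w \<sigma> t has_real_derivative D) (at x)" by blast
    next
      fix t x assume t0: "0 < t" "t \<le> T" and w0: "w \<sigma> t x = 0" and wx0: "(w \<sigma> t has_real_derivative 0) (at x)"
      have t: "t \<in> {0..T}" using t0 by auto
      have "((\<lambda>x. u t (x + h)) has_real_derivative ux t (x + h)) (at x)"
        using ux[OF t, of "x + h"] by (simp add: DERIV_shift)
      then have "(w \<sigma> t has_real_derivative \<sigma> * (ux t (x + h) - ux t x) - h * b * exp (rate * t) * \<psi>' x) (at x)"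
        unfolding w_def[abs_def] using ux[OF t, of x] \<psi>'(1)[of x] by (auto intro!: derivative_eq_intros)
      from DERIV_unique[OF this wx0]
      have slope: "\<sigma> * (ux t (x + h) - ux t x) = h * b * exp (rate * t) * \<psi>' x" by simp
      have height: "\<sigma> * (u t (x + h) - u t x) = h * b * exp (rate * t) * \<psi> x" using w0 by (simp add: w_def)
      define B where "B = h * b * exp (rate * t) * \<psi> x"
      have B: "B > 0" using h b \<psi>_pos[of x] by (simp add: B_def)
      define E where "E = L * exp (rate * t) * (exp (\<alpha> * h) * \<psi> x)"
      have E: "E \<ge> 0" using L \<psi>_pos[of x] by (simp add: E_def)
      have transport: "\<bar>u t (x + h) * ux t (x + h) - u t x * ux t x\<bar> \<le> 2 * M * B"
      proof -
        have "\<bar>u t (x + h) * ux t (x + h) - u t x * ux t x\<bar>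
          = \<bar>u t (x + h) * (\<sigma> * (ux t (x + h) - ux t x)) + (\<sigma> * (u t (x + h) - u t x)) * ux t x\<bar>"
          using abs\<sigma>[of "u t (x + h) * ux t (x + h) - u t x * ux t x"] by (simp add: algebra_simps)
        also have "\<dots> \<le> \<bar>u t (x + h)\<bar> * \<bar>h * b * exp (rate * t) * \<psi>' x\<bar> + \<bar>B\<bar> * \<bar>ux t x\<bar>"
          unfolding slope height B_def[symmetric] by (simp only: abs_mult[symmetric] abs_triangle_ineq)
        also have "\<dots> \<le> M * B + B * M"
        proof (intro add_mono mult_mono)
          show "\<bar>h * b * exp (rate * t) * \<psi>' x\<bar> \<le> B"
            unfolding B_def abs_mult using h b \<psi>'(2)[of x] by simp
        qed (use u_le[OF t] ux_le[OF t] M_nonneg B in auto)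
        finally show ?thesis by (simp add: mult_ac)
      qed
      have nonlocal: "\<bar>Px t (x + h) - Px t x\<bar> \<le> h * (3 * c * M * E)"
      proof -
        have "\<exists>z. x < z \<and> z < x + h \<and> Px t (x + h) - Px t x
           = (x + h - x) * ((right_tail (F t) z + left_tail (F t) z) / 2 - F t z)"
          using h Px_derivative[OF t] by (intro MVT2) auto
        then obtain z where z: "x < z" "z < x + h"
          "Px t (x + h) - Px t x = h * ((right_tail (F t) z + left_tail (F t) z) / 2 - F t z)" by auto
        define Z where "Z = 3/2 * M * (L * exp (rate * t) * \<psi> z)"
        have "\<psi> z \<le> exp (\<alpha> * h) * \<psi> x" using z \<alpha> \<epsilon> by (intro decay_weight_translate) auto
        then have ZE: "Z \<le> 3/2 * M * E"
          unfolding Z_def E_def using M_nonneg L by (intro mult_left_mono) auto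
        have Z0: "Z \<ge> 0" unfolding Z_def using M_nonneg L \<psi>_pos[of z] by simp
        have "\<bar>(right_tail (F t) z + left_tail (F t) z) / 2 - F t z\<bar> \<le> c * Z + Z"
          using tails_bound(2,3,1)[OF dom t, of z] unfolding Z_def[symmetric] by (rule abs_half_sum_diff_le)
        also have "\<dots> \<le> 2 * c * Z" using mult_right_mono[OF c_ge_1 Z0] by (simp add: mult_ac)
        also have "\<dots> \<le> 2 * c * (3/2 * M * E)" using ZE c_ge_1 by (intro mult_left_mono) auto
        finally have "\<bar>(right_tail (F t) z + left_tail (F t) z) / 2 - F t z\<bar> \<le> 3 * c * M * E" by (simp add: mult_ac)
        then show ?thesis unfolding z(3) abs_mult using h by (simp add: mult_left_mono)
      qed
      have "((\<lambda>\<tau>. w \<sigma> \<tau> x) has_real_derivative \<sigma> * (ut t (x + h) - ut t x) - rate * B) (at t within {0..T})"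
        unfolding w_def[abs_def] B_def
        using u_time_derivative[OF t, of "x + h"] u_time_derivative[OF t, of x]
        by (auto intro!: derivative_eq_intros simp: algebra_simps)
      moreover have "\<sigma> * (ut t (x + h) - ut t x) - rate * B < 0"
      proof -
        have "\<sigma> * (ut t (x + h) - ut t x) \<le> \<bar>ut t (x + h) - ut t x\<bar>"
          using abs\<sigma> abs_ge_self by metis
        also have "\<dots> \<le> 2 * M * B + h * (3 * c * M * E)"
          using transport nonlocal unfolding ut_def by linarith
        also have "h * (3 * c * M * E) \<le> 6 * c * M * B"
        proof -
          have "h * E \<le> 2 * B"
          proof -
            define k where "k = A + L / 2 + \<delta>"
            have "L \<le> 2 * k" using A \<delta> by (simp add: k_def)
            then have "L * (h * exp (rate * t) * exp (\<alpha> * h) * \<psi> x) \<le> 2 * k * (h * exp (rate * t) * exp (\<alpha> * h) * \<psi> x)"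
              using h \<psi>_pos[of x] by (intro mult_right_mono) auto
            then show ?thesis by (simp add: E_def B_def b_def k_def[symmetric] mult_ac)
          qed
          then have "3 * c * M * (h * E) \<le> 3 * c * M * (2 * B)"
            using c_ge_1 M_nonneg by (intro mult_left_mono) auto
          then show ?thesis by (simp add: mult_ac)
        qed
        finally show ?thesis using B by (simp add: rate_def algebra_simps)
      qed
      ultimately show "\<exists>D<0. ((\<lambda>\<tau>. w \<sigma> \<tau> x) has_real_derivative D) (at t within {0..T})" by blast
    qed
  qed
  from w[of 1] w[of "-1"] show ?thesis by (simp add: w_def b_def abs_le_iff mult_ac)
qed

text \<open>Divide the increment by \<open>h\<close>, let \<open>h\<close> tend to \<open>0\<close>, and then \<open>\<delta>\<close>.\<close>
lemma dominated_improve: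
  assumes dom: "dominated L"
  shows "dominated (A + L / 2)"
  unfolding dominated_def
proof (intro ballI allI conjI)
  fix t x assume t: "t \<in> {0..T}"
  show "\<bar>u t x\<bar> \<le> (A + L / 2) * exp (rate * t) * \<psi> x"
    by (rule dominated_u_improve[OF dom t])
  have "\<bar>ux t x\<bar> \<le> (A + L / 2 + \<delta>) * exp (rate * t) * \<psi> x" if \<delta>: "\<delta> > 0" for \<delta>
  proof (rule tendsto_le[OF _ _ tendsto_rabs])
    show "((\<lambda>h. (u t (x + h) - u t x) / h) \<longlongrightarrow> ux t x) (at_right 0)"
      using ux[OF t, of x] unfolding DERIV_def by (rule filterlim_mono) (auto simp: at_le)
    have "((\<lambda>h. (A + L / 2 + \<delta>) * exp (\<alpha> * h) * exp (rate * t) * \<psi> x) \<longlongrightarrow>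
       (A + L / 2 + \<delta>) * exp (\<alpha> * 0) * exp (rate * t) * \<psi> x) (at_right 0)"
      by (intro tendsto_intros)
    then show "((\<lambda>h. (A + L / 2 + \<delta>) * exp (\<alpha> * h) * exp (rate * t) * \<psi> x) \<longlongrightarrow> (A + L / 2 + \<delta>) * exp (rate * t) * \<psi> x) (at_right 0)"
      by simp
    show "\<forall>\<^sub>F h in at_right 0. \<bar>(u t (x + h) - u t x) / h\<bar> \<le> (A + L / 2 + \<delta>) * exp (\<alpha> * h) * exp (rate * t) * \<psi> x"
      unfolding eventually_at_filter
      using dominated_increment[OF dom t _ \<delta>, of _ x]
      by (intro always_eventually) (auto simp: divide_le_eq mult.commute)
  qed simp
  then have "\<bar>ux t x\<bar> \<le> (A + L / 2) * exp (rate * t) * \<psi> x + e" if "e > 0" for e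
  proof -
    define k where "k = exp (rate * t) * \<psi> x"
    have k: "k > 0" using \<psi>_pos[of x] by (simp add: k_def)
    have "\<bar>ux t x\<bar> \<le> (A + L / 2 + e / k) * k"
      using \<open>\<And>\<delta>. \<delta> > 0 \<Longrightarrow> _\<close>[of "e / k"] that k by (simp add: k_def mult.assoc)
    also have "\<dots> = (A + L / 2) * k + e" using k by (simp add: distrib_right)
    finally show ?thesis by (simp add: k_def mult.assoc)
  qed
  then show "\<bar>ux t x\<bar> \<le> (A + L / 2) * exp (rate * t) * \<psi> x"
    by (rule field_le_epsilon)
qed

text \<open>Here \<open>\<epsilon> > 0\<close> is essential: the solution is only known to be bounded, and the weight is bounded below.\<close>
lemma dominated_some: "\<exists>L. dominated L"
proof (intro exI)
  show "dominated (M / min 1 \<epsilon>)"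
    unfolding dominated_def
  proof (intro ballI allI)
    fix t x assume t: "t \<in> {0..T}"
    have "M / min 1 \<epsilon> * 1 * min 1 \<epsilon> \<le> M / min 1 \<epsilon> * exp (rate * t) * \<psi> x"
      using M_nonneg \<epsilon> t rate_pos decay_weight_lower_bound[of \<epsilon> \<alpha> x] by (intro mult_mono) auto
    moreover have "M / min 1 \<epsilon> * 1 * min 1 \<epsilon> = M" using \<epsilon> by simp
    ultimately show "\<bar>u t x\<bar> \<le> M / min 1 \<epsilon> * exp (rate * t) * \<psi> x \<and> \<bar>ux t x\<bar> \<le> M / min 1 \<epsilon> * exp (rate * t) * \<psi> x"
      using u_le[OF t, of x] ux_le[OF t, of x] by auto
  qed
qed

text \<open>The fixed point of the contraction \<open>L \<mapsto> A + L/2\<close> is \<open>2 A\<close>.\<close>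
lemma dominated_2A: "dominated (2 * A)"
proof -
  obtain L where L: "dominated L" using dominated_some by blast
  have iter: "dominated (2 * A + (L - 2 * A) / 2 ^ n)" for n
  proof (induction n)
    case 0
    then show ?case using L by simp
  next
    case (Suc n)
    from dominated_improve[OF Suc] show ?case by (simp add: field_simps)
  qed
  have lim: "(\<lambda>n. (2 * A + (L - 2 * A) / 2 ^ n) * exp (rate * t) * \<psi> x) \<longlonglongrightarrow> (2 * A + 0) * exp (rate * t) * \<psi> x" for t x
    by (intro tendsto_intros LIMSEQ_divide_realpow_zero) auto
  show ?thesis
    unfolding dominated_def
  proof (intro ballI allI conjI)
    fix t x assume t: "t \<in> {0..T}"
    show "\<bar>u t x\<bar> \<le> 2 * A * exp (rate * t) * \<psi> x"
      using LIMSEQ_le_const[OF lim[of t x], of "\<bar>u t x\<bar>"] iter t by (auto simp: dominated_def)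
    show "\<bar>ux t x\<bar> \<le> 2 * A * exp (rate * t) * \<psi> x"
      using LIMSEQ_le_const[OF lim[of t x], of "\<bar>ux t x\<bar>"] iter t by (auto simp: dominated_def)
  qed
qed

end

context classical_CH_solution
begin

text \<open>The constant \<open>B\<close> does not depend on \<open>A\<close>; so \<open>A = 0\<close> is allowed and yields uniqueness.\<close>
theorem persistence_of_decay:
  assumes \<alpha>: "0 < \<alpha>" "\<alpha> < 1"
  obtains B where "B \<ge> 0" "\<And>A t x. A \<ge> 0 \<Longrightarrow> (\<And>x. \<bar>u 0 x\<bar> \<le> A * exp (- (\<alpha> * x))) \<Longrightarrow>
    (\<And>x. \<bar>ux 0 x\<bar> \<le> A * exp (- (\<alpha> * x))) \<Longrightarrow> t \<in> {0..T} \<Longrightarrow>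
    \<bar>u t x\<bar> \<le> A * B * exp (- (\<alpha> * x)) \<and> \<bar>ux t x\<bar> \<le> A * B * exp (- (\<alpha> * x))"
proof
  define rate where "rate = weighted_CH_solution.rate M \<alpha>"
  define B where "B = 2 * exp (rate * T)"
  show "B \<ge> 0" by (simp add: B_def)
  fix A t x :: real
  assume A: "A \<ge> 0" and u0: "\<And>x. \<bar>u 0 x\<bar> \<le> A * exp (- (\<alpha> * x))" and ux0: "\<And>x. \<bar>ux 0 x\<bar> \<le> A * exp (- (\<alpha> * x))"
    and t: "t \<in> {0..T}"
  have weighted: "\<bar>u t x\<bar> \<le> A * B * decay_weight \<alpha> \<epsilon> x \<and> \<bar>ux t x\<bar> \<le> A * B * decay_weight \<alpha> \<epsilon> x" if \<epsilon>: "\<epsilon> > 0" for \<epsilon>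
  proof -
    have le: "A * exp (- (\<alpha> * y)) \<le> A * decay_weight \<alpha> \<epsilon> y" for y
      using A \<epsilon> by (intro mult_left_mono) (auto simp: decay_weight_def)
    interpret W: weighted_CH_solution T M u ux \<alpha> \<epsilon> A
      using \<alpha> \<epsilon> A order_trans[OF u0 le] order_trans[OF ux0 le] by unfold_locales
    have "2 * A * exp (rate * t) * decay_weight \<alpha> \<epsilon> x \<le> A * B * decay_weight \<alpha> \<epsilon> x"
    proof -
      have "rate * t \<le> rate * T" unfolding rate_def using W.rate_pos t by simp
      then have "A * (2 * exp (rate * t)) \<le> A * B" unfolding B_def using A by (intro mult_left_mono) auto
      then have "A * (2 * exp (rate * t)) * decay_weight \<alpha> \<epsilon> x \<le> A * B * decay_weight \<alpha> \<epsilon> x"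
        using W.\<psi>_pos[of x] by (intro mult_right_mono) auto
      then show ?thesis by (simp add: mult_ac)
    qed
    then show ?thesis using W.dominated_2A t unfolding W.dominated_def rate_def by (meson order_trans)
  qed
  have lim: "((\<lambda>\<epsilon>. A * B * decay_weight \<alpha> \<epsilon> x) \<longlongrightarrow> A * B * exp (- (\<alpha> * x))) (at_right 0)"
  proof -
    have "((\<lambda>\<epsilon>. A * B * decay_weight \<alpha> \<epsilon> x) \<longlongrightarrow> A * B * (exp (- (\<alpha> * x)) + 0 * exp (\<alpha> * x))) (at_right 0)"
      unfolding decay_weight_def by (intro tendsto_intros)
    then show ?thesis by simp
  qed
  have ev: "\<forall>\<^sub>F \<epsilon> in at_right 0. \<bar>u t x\<bar> \<le> A * B * decay_weight \<alpha> \<epsilon> x"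
      "\<forall>\<^sub>F \<epsilon> in at_right 0. \<bar>ux t x\<bar> \<le> A * B * decay_weight \<alpha> \<epsilon> x"
    using weighted by (auto simp: eventually_at_filter)
  show "\<bar>u t x\<bar> \<le> A * B * exp (- (\<alpha> * x)) \<and> \<bar>ux t x\<bar> \<le> A * B * exp (- (\<alpha> * x))"
    using tendsto_lowerbound[OF lim ev(1)] tendsto_lowerbound[OF lim ev(2)] by simp
qed

lemma zero_initial_datum:
  assumes u0: "\<And>x. u 0 x = 0" and t: "t \<in> {0..T}"
  shows "u t x = 0"
proof -
  have 0: "0 \<in> {0..T}" using T by auto
  have "u 0 = (\<lambda>x. 0)" using u0 by auto
  then have "ux 0 x = 0" for x
    using ux[OF 0, of x] DERIV_unique[OF _ DERIV_const] by metis
  moreover obtain B where "\<And>A t x. A \<ge> 0 \<Longrightarrow> (\<And>x. \<bar>u 0 x\<bar> \<le> A * exp (- (1/2 * x))) \<Longrightarrow>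
    (\<And>x. \<bar>ux 0 x\<bar> \<le> A * exp (- (1/2 * x))) \<Longrightarrow> t \<in> {0..T} \<Longrightarrow>
    \<bar>u t x\<bar> \<le> A * B * exp (- (1/2 * x)) \<and> \<bar>ux t x\<bar> \<le> A * B * exp (- (1/2 * x))"
    by (rule persistence_of_decay[of "1/2"]) auto
  from this[of 0 t x] u0 t calculation show ?thesis by simp
qed

lemma time_increment_ge:
  assumes ab: "0 \<le> a" "a \<le> b" "b \<le> T" and r: "\<And>\<tau>. a \<le> \<tau> \<Longrightarrow> \<tau> \<le> b \<Longrightarrow> ut \<tau> x \<ge> r"
  shows "u b x - u a x \<ge> r * (b - a)"
proof -
  define g where "g \<tau> = u \<tau> x - r * \<tau>" for \<tau>
  have D: "(g has_real_derivative ut \<tau> x - r) (at \<tau> within {0..T})" if "\<tau> \<in> {0..T}" for \<tau>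
    unfolding g_def[abs_def] using u_time_derivative[OF that, of x] by (auto intro!: derivative_eq_intros)
  have "g a \<le> g b"
  proof (rule DERIV_nonneg_imp_increasing_open[where f = g])
    have "continuous_on {0..T} g" using D by (rule DERIV_continuous_on)
    then show "continuous_on {a..b} g" by (rule continuous_on_subset) (use ab in auto)
    fix \<tau> assume \<tau>: "a < \<tau>" "\<tau> < b"
    then have "(g has_real_derivative ut \<tau> x - r) (at \<tau>)"
      using D[of \<tau>] ab by (simp add: at_within_Icc_at)
    then show "\<exists>y. (g has_real_derivative y) (at \<tau>) \<and> 0 \<le> y" using r[of \<tau>] \<tau> by auto
  qed (use ab in auto)
  then show ?thesis by (simp add: g_def algebra_simps)
qed

lemma left_tail_nonneg: "left_tail (F t) x \<ge> 0"
  unfolding left_tail_def by (intro integral_nonneg_AE) (auto simp: F_nonneg)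

lemma exp_left_tail_mono:
  assumes t: "t \<in> {0..T}" and "x \<le> y"
  shows "exp x * left_tail (F t) x \<le> exp y * left_tail (F t) y"
proof (rule DERIV_nonneg_imp_nondecreasing[OF \<open>x \<le> y\<close>])
  fix z
  have "((\<lambda>z. exp z * left_tail (F t) z) has_real_derivative exp z * left_tail (F t) z + exp z * (F t z - left_tail (F t) z)) (at z)"
    using left_tail_derivative[OF F_continuous[OF t] F_le[OF t], of z]
    by (auto intro!: derivative_eq_intros)
  then have "((\<lambda>z. exp z * left_tail (F t) z) has_real_derivative exp z * F t z) (at z)"
    by (simp add: algebra_simps)
  then show "\<exists>y. ((\<lambda>z. exp z * left_tail (F t) z) has_real_derivative y) (at z) \<and> 0 \<le> y"
    using F_nonneg[of t z] by (intro exI[of _ "exp z * F t z"] conjI) auto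
qed

text \<open>If the tail vanished identically, so would its derivative, which is \<open>F\<close> minus the tail.\<close>
lemma left_tail_positive_somewhere:
  assumes t: "t \<in> {0..T}" and "u t y \<noteq> 0"
  shows "\<exists>x. left_tail (F t) x > 0"
proof (rule ccontr)
  assume "\<nexists>x. 0 < left_tail (F t) x"
  then have "left_tail (F t) = (\<lambda>x. 0)"
    using left_tail_nonneg[of t] by (auto simp: fun_eq_iff not_less intro: antisym)
  with left_tail_derivative[OF F_continuous[OF t] F_le[OF t], of y]
  have "((\<lambda>x. 0) has_real_derivative F t y) (at y)" by simp
  then have "F t y = 0" using DERIV_unique[OF _ DERIV_const] by blast
  moreover have "(u t y)\<^sup>2 > 0" using assms by simp
  ultimately show False unfolding F_def using zero_le_power2[of "ux t y"] by linarith
qed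

text \<open>\<open>F\<close> is continuous in time with values in the bounded functions, and the tail operator has norm \<open>1\<close> on them.\<close>
lemma left_tail_lower_near_time_0:
  assumes m: "left_tail (F 0) x = m" "m > 0"
  obtains d where "d > 0" "\<And>\<tau>. 0 \<le> \<tau> \<Longrightarrow> \<tau> < d \<Longrightarrow> \<tau> \<le> T \<Longrightarrow> left_tail (F \<tau>) x \<ge> m / 2"
proof -
  have 0: "0 \<in> {0..T}" using T by auto
  \<comment> \<open>\<open>F\<close> changes by at most \<open>3 M e\<close> when \<open>u\<close> and \<open>u\<^sub>x\<close> change by at most \<open>e\<close>.\<close>
  define e where "e = m / (6 * (M + 1))"
  have e: "e > 0" using m M_nonneg by (simp add: e_def)
  have e3: "3 * M * e \<le> m / 2" using m M_nonneg by (simp add: e_def field_simps)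
  obtain d where d: "d > 0" "\<And>\<tau> y. \<tau> \<in> {0..T} \<Longrightarrow> \<bar>\<tau> - 0\<bar> < d \<Longrightarrow> \<bar>u \<tau> y - u 0 y\<bar> \<le> e \<and> \<bar>ux \<tau> y - ux 0 y\<bar> \<le> e"
    using time_continuous[OF 0 e] by blast
  show ?thesis
  proof (rule that[OF d(1)])
    fix \<tau> assume \<tau>: "0 \<le> \<tau>" "\<tau> < d" "\<tau> \<le> T"
    then have \<tau>': "\<tau> \<in> {0..T}" by simp
    have close: "\<bar>F 0 y - F \<tau> y\<bar> \<le> m / 2" for y
    proof -
      have sq: "\<bar>a\<^sup>2 - b\<^sup>2\<bar> \<le> 2 * M * e" if "\<bar>a\<bar> \<le> M" "\<bar>b\<bar> \<le> M" "\<bar>b - a\<bar> \<le> e" for a b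
      proof -
        have "\<bar>a\<^sup>2 - b\<^sup>2\<bar> = \<bar>a + b\<bar> * \<bar>b - a\<bar>"
          by (simp add: power2_eq_square abs_mult[symmetric] algebra_simps abs_minus_commute)
        also have "\<dots> \<le> (2 * M) * e" using that M_nonneg by (intro mult_mono) auto
        finally show ?thesis .
      qed
      have "\<bar>(u 0 y)\<^sup>2 - (u \<tau> y)\<^sup>2\<bar> \<le> 2 * M * e" "\<bar>(ux 0 y)\<^sup>2 - (ux \<tau> y)\<^sup>2\<bar> \<le> 2 * M * e"
        using d(2)[OF \<tau>', of y] \<tau> u_le[OF 0] u_le[OF \<tau>'] ux_le[OF 0] ux_le[OF \<tau>'] by (auto intro!: sq)
      then have "\<bar>F 0 y - F \<tau> y\<bar> \<le> 3 * M * e" unfolding F_def by (simp add: abs_le_iff algebra_simps)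
      with e3 show ?thesis by simp
    qed
    have [measurable]: "F 0 \<in> borel_measurable borel" "F \<tau> \<in> borel_measurable borel"
      using F_measurable 0 \<tau>' by auto
    have int: "integrable lborel (\<lambda>z. indicator {0..} z * exp (- z) * F s (x - z))" if "s \<in> {0..T}" for s
      by (rule left_tail_integrable_bound(1)[OF F_measurable[OF that], of 0 _ "3/2 * M * M"]) (use F_le[OF that] in auto)
    have "left_tail (F 0) x - left_tail (F \<tau>) x = left_tail (\<lambda>y. F 0 y - F \<tau> y) x"
      unfolding left_tail_def
      by (simp only: right_diff_distrib Bochner_Integration.integral_diff[OF int[OF 0] int[OF \<tau>']])
    also have "\<dots> \<le> (m / 2) / (1 - 0)"
      by (rule order_trans[OF abs_ge_self left_tail_integrable_bound(2)]) (use close in auto)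
    finally show "left_tail (F \<tau>) x \<ge> m / 2" using m by simp
  qed
qed

text \<open>If the datum is not zero, the left tail contributes at least a multiple of \<open>e\<^sup>-\<^sup>x\<close> to \<open>u(x,t\<^sub>1) - u(x,0)\<close> during
  a short initial interval \<open>[0,s]\<close>, and a nonnegative amount later. All other terms are of the order
  \<open>e\<^sup>-\<^sup>2\<^sup>\<alpha>\<^sup>x\<close>, and both endpoint values are \<open>o(e\<^sup>-\<^sup>x)\<close>.\<close>
theorem decay_at_two_times_implies_zero:
  assumes \<alpha>: "1/2 < \<alpha>" "\<alpha> < 1"
    and A: "A \<ge> 0" "\<And>x. \<bar>u 0 x\<bar> \<le> A * exp (- (\<alpha> * x))" "\<And>x. \<bar>ux 0 x\<bar> \<le> A * exp (- (\<alpha> * x))"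
    and t1: "t\<^sub>1 \<in> {0<..T}"
    and small0: "\<And>e. e > 0 \<Longrightarrow> eventually (\<lambda>x. \<bar>u 0 x\<bar> \<le> e * exp (- x)) at_top"
    and small1: "\<And>e. e > 0 \<Longrightarrow> eventually (\<lambda>x. \<bar>u t\<^sub>1 x\<bar> \<le> e * exp (- x)) at_top"
    and t: "t \<in> {0..T}"
  shows "u t x = 0"
proof (rule zero_initial_datum[OF _ t], rule ccontr)
  fix y assume "u 0 y \<noteq> 0"
  have 0: "0 \<in> {0..T}" using T by auto
  obtain x0 m where m: "left_tail (F 0) x0 = m" "m > 0"
    using left_tail_positive_somewhere[OF 0 \<open>u 0 y \<noteq> 0\<close>] by blast
  obtain d where d: "d > 0" "\<And>\<tau>. 0 \<le> \<tau> \<Longrightarrow> \<tau> < d \<Longrightarrow> \<tau> \<le> T \<Longrightarrow> left_tail (F \<tau>) x0 \<ge> m / 2"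
    using left_tail_lower_near_time_0[OF m] by blast
  obtain B where B: "B \<ge> 0" "\<And>A t x. A \<ge> 0 \<Longrightarrow> (\<And>x. \<bar>u 0 x\<bar> \<le> A * exp (- (\<alpha> * x))) \<Longrightarrow>
    (\<And>x. \<bar>ux 0 x\<bar> \<le> A * exp (- (\<alpha> * x))) \<Longrightarrow> t \<in> {0..T} \<Longrightarrow>
    \<bar>u t x\<bar> \<le> A * B * exp (- (\<alpha> * x)) \<and> \<bar>ux t x\<bar> \<le> A * B * exp (- (\<alpha> * x))"
    by (rule persistence_of_decay[of \<alpha>]) (use \<alpha> in auto)
  define K where "K = A * B"
  have K0: "K \<ge> 0" using A B by (simp add: K_def)
  have K: "\<bar>u \<tau> x\<bar> \<le> K * exp (- (\<alpha> * x))" "\<bar>ux \<tau> x\<bar> \<le> K * exp (- (\<alpha> * x))" if "\<tau> \<in> {0..T}" for \<tau> x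
    using B(2)[OF A that, of x] unfolding K_def by auto
  define s where "s = min (d / 2) t\<^sub>1"
  have s: "0 < s" "s < d" "s \<le> t\<^sub>1" "t\<^sub>1 \<le> T" using d(1) t1 by (auto simp: s_def)
  \<comment> \<open>Half of the lower bound \<open>e\<^sup>x\<^sup>0 m / 2\<close> for \<open>e\<^sup>x\<close> times the left tail at times in \<open>[0,s]\<close> and \<open>x \<ge> x0\<close>.\<close>
  define q where "q = exp x0 * m / 4"
  have q: "q > 0" using m by (simp add: q_def)
  \<comment> \<open>The transport term contributes \<open>1\<close> and the right tail \<open>3/4\<close> to the constant \<open>2\<close>.\<close>
  have ut_ge: "ut \<tau> x \<ge> left_tail (F \<tau>) x / 2 - 2 * K\<^sup>2 * exp (- (2 * \<alpha> * x))" if \<tau>: "\<tau> \<in> {0..T}" for \<tau> x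
  proof -
    define E where "E = K\<^sup>2 * exp (- (2 * \<alpha> * x))"
    have sq: "(K * exp (- (\<alpha> * x))) * (K * exp (- (\<alpha> * x))) = K\<^sup>2 * exp (- (2 * \<alpha> * x))" for x
      by (simp add: power2_eq_square exp_add[symmetric] algebra_simps)
    have E0: "E \<ge> 0" by (simp add: E_def)
    have "\<bar>u \<tau> x * ux \<tau> x\<bar> \<le> E"
      unfolding E_def sq[symmetric] abs_mult using K[OF \<tau>, of x] K0 by (intro mult_mono) auto
    moreover have "\<bar>right_tail (F \<tau>) x\<bar> \<le> (3/2 * E) / (1 - 0)"
    proof (rule right_tail_bound[OF F_measurable[OF \<tau>]])
      fix z :: real assume z: "z \<ge> 0"
      have "\<bar>u \<tau> (x + z)\<bar> * \<bar>u \<tau> (x + z)\<bar> \<le> K\<^sup>2 * exp (- (2 * \<alpha> * (x + z)))"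
        "\<bar>ux \<tau> (x + z)\<bar> * \<bar>ux \<tau> (x + z)\<bar> \<le> K\<^sup>2 * exp (- (2 * \<alpha> * (x + z)))"
        unfolding sq[symmetric] using K[OF \<tau>, of "x + z"] K0 by (auto intro!: mult_mono simp del: abs_mult_self_eq)
      then have "\<bar>F \<tau> (x + z)\<bar> \<le> 3/2 * (K\<^sup>2 * exp (- (2 * \<alpha> * (x + z))))"
        by (simp add: F_def power2_eq_square)
      also have "\<dots> \<le> 3/2 * (K\<^sup>2 * exp (- (2 * \<alpha> * x)))"
        using \<alpha> z by (intro mult_left_mono) auto
      finally show "\<bar>F \<tau> (x + z)\<bar> \<le> 3/2 * E * exp (0 * z)" by (simp add: E_def)
    qed simp
    ultimately have "u \<tau> x * ux \<tau> x \<le> E" "right_tail (F \<tau>) x \<le> 3/2 * E"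
      by (simp_all add: abs_le_iff)
    then have "ut \<tau> x \<ge> left_tail (F \<tau>) x / 2 - 2 * E"
      unfolding ut_def Px_def diff_divide_distrib using E0 by linarith
    then show ?thesis by (simp add: E_def mult.assoc)
  qed
  have contribution: "u t\<^sub>1 x - u 0 x \<ge> s * q * exp (- x) - 2 * K\<^sup>2 * T * exp (- (2 * \<alpha> * x))" if x: "x \<ge> x0" for x
  proof -
    define r where "r = 2 * K\<^sup>2 * exp (- (2 * \<alpha> * x))"
    have r: "r \<ge> 0" by (simp add: r_def)
    have "u s x - u 0 x \<ge> (q * exp (- x) - r) * (s - 0)"
    proof (rule time_increment_ge)
      fix \<tau> assume \<tau>: "0 \<le> \<tau>" "\<tau> \<le> s"
      then have \<tau>': "\<tau> \<in> {0..T}" using s by auto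
      have "exp x0 * (m / 2) \<le> exp x0 * left_tail (F \<tau>) x0"
        using d(2)[of \<tau>] \<tau> s by (intro mult_left_mono) auto
      also have "\<dots> \<le> exp x * left_tail (F \<tau>) x" by (rule exp_left_tail_mono[OF \<tau>' x])
      finally have "2 * q \<le> exp x * left_tail (F \<tau>) x" by (simp add: q_def mult.commute)
      then have "q * exp (- x) \<le> left_tail (F \<tau>) x / 2" by (simp add: exp_minus field_simps)
      with ut_ge[OF \<tau>', of x] show "q * exp (- x) - r \<le> ut \<tau> x" by (simp add: r_def)
    qed (use s in auto)
    moreover have "u t\<^sub>1 x - u s x \<ge> (- r) * (t\<^sub>1 - s)"
    proof (rule time_increment_ge)
      fix \<tau> assume \<tau>: "s \<le> \<tau>" "\<tau> \<le> t\<^sub>1"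
      then have \<tau>': "\<tau> \<in> {0..T}" using s by auto
      from ut_ge[OF \<tau>', of x] left_tail_nonneg[of \<tau> x] show "- r \<le> ut \<tau> x" by (simp add: r_def)
    qed (use s in auto)
    ultimately have "u t\<^sub>1 x - u 0 x \<ge> s * q * exp (- x) - r * t\<^sub>1"
      by (simp add: algebra_simps)
    moreover have "r * t\<^sub>1 \<le> r * T" using r s by (intro mult_left_mono) auto
    ultimately show ?thesis by (simp add: r_def algebra_simps)
  qed
  have lim: "((\<lambda>x. 2 * K\<^sup>2 * T * exp (- ((2 * \<alpha> - 1) * x))) \<longlongrightarrow> 2 * K\<^sup>2 * T * 0) at_top"
  proof (intro tendsto_mult tendsto_const)
    have "filterlim (\<lambda>x. (2 * \<alpha> - 1) * x) at_top at_top"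
      using \<alpha> by (intro filterlim_tendsto_pos_mult_at_top[OF tendsto_const]) (auto simp: filterlim_ident)
    then show "((\<lambda>x. exp (- ((2 * \<alpha> - 1) * x))) \<longlongrightarrow> 0) at_top"
      by (intro filterlim_compose[OF exp_at_bot]) (simp add: filterlim_uminus_at_top)
  qed
  have sq: "s * q / 4 > 0" using s q by simp
  have "eventually (\<lambda>x. 2 * K\<^sup>2 * T * exp (- ((2 * \<alpha> - 1) * x)) < s * q / 4) at_top"
    using order_tendstoD(2)[OF lim, of "s * q / 4"] sq by simp
  moreover note small0[OF sq] small1[OF sq] eventually_ge_at_top[of x0]
  ultimately have "eventually (\<lambda>x::real. False) at_top"
  proof eventually_elim
    case (elim x)
    have "exp (- (2 * \<alpha> * x)) = exp (- ((2 * \<alpha> - 1) * x)) * exp (- x)"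
      by (simp add: exp_add[symmetric] algebra_simps)
    then have "2 * K\<^sup>2 * T * exp (- (2 * \<alpha> * x)) < s * q / 4 * exp (- x)"
      using elim(1) by simp
    moreover have "s * q * exp (- x) > 0" using s q by simp
    ultimately show ?case using contribution[OF elim(4)] elim(2,3) by (simp add: abs_le_iff)
  qed
  then show False by simp
qed

end

section \<open>Strong solutions are classical solutions\<close>

text \<open>Compactness of the time interval, in the form of a bisection argument.\<close>
lemma uniform_bound_on_interval:
  fixes f :: "real \<Rightarrow> 'a \<Rightarrow> real"
  assumes ptw: "\<And>t. t \<in> {0..T} \<Longrightarrow> \<exists>B. \<forall>x. \<bar>f t x\<bar> \<le> B"
    and cont: "\<And>t. t \<in> {0..T} \<Longrightarrow> \<exists>d>0. \<forall>\<tau>\<in>{0..T}. \<bar>\<tau> - t\<bar> < d \<longrightarrow> (\<forall>x. \<bar>f \<tau> x - f t x\<bar> \<le> 1)"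
    and T: "0 \<le> T"
  shows "\<exists>B. \<forall>t\<in>{0..T}. \<forall>x. \<bar>f t x\<bar> \<le> B"
proof -
  have "\<exists>B. \<forall>t\<in>{0..T} \<inter> {0..T}. \<forall>x. \<bar>f t x\<bar> \<le> B"
    using T
  proof (induction rule: Bolzano[where P = "\<lambda>a b. \<exists>B. \<forall>t\<in>{a..b} \<inter> {0..T}. \<forall>x. \<bar>f t x\<bar> \<le> B"])
    case (trans a b c)
    then obtain B B' where B: "\<forall>t\<in>{a..b} \<inter> {0..T}. \<forall>x. \<bar>f t x\<bar> \<le> B" "\<forall>t\<in>{b..c} \<inter> {0..T}. \<forall>x. \<bar>f t x\<bar> \<le> B'"
      by blast
    show ?case
    proof (intro exI ballI allI)
      fix t x assume "t \<in> {a..c} \<inter> {0..T}"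
      then have "t \<in> {a..b} \<inter> {0..T} \<or> t \<in> {b..c} \<inter> {0..T}" by auto
      then show "\<bar>f t x\<bar> \<le> max B B'" using B by (auto simp: le_max_iff_disj)
    qed
  next
    case (local t)
    then have t: "t \<in> {0..T}" by auto
    obtain B where B: "\<And>x. \<bar>f t x\<bar> \<le> B" using ptw[OF t] by blast
    obtain d where d: "d > 0" "\<And>\<tau> x. \<tau> \<in> {0..T} \<Longrightarrow> \<bar>\<tau> - t\<bar> < d \<Longrightarrow> \<bar>f \<tau> x - f t x\<bar> \<le> 1"
      using cont[OF t] by blast
    have "\<bar>f \<tau> x\<bar> \<le> B + 1" if "a \<le> t" "t \<le> b" "b - a < d" "\<tau> \<in> {a..b} \<inter> {0..T}" for a b \<tau> x
    proof -
      have "\<bar>\<tau> - t\<bar> < d" using that by (auto simp: abs_less_iff)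
      then have "\<bar>f \<tau> x - f t x\<bar> \<le> 1" using d(2)[of \<tau> x] that by blast
      then show ?thesis using B[of x] by linarith
    qed
    then show ?case using d(1) by blast
  qed
  then show ?thesis by simp
qed

text \<open>The two embeddings turn continuity in \<open>H\<^sup>s\<close> into continuity of \<open>u\<close> and \<open>u\<^sub>x\<close> in the sup norm. By the
  equation, the \<open>H\<^sup>s\<^sup>-\<^sup>1\<close> time derivative agrees almost everywhere with the continuous function \<open>w\<close> below;
  the embedding of \<open>H\<^sup>s\<^sup>-\<^sup>1\<close> then shows that the difference quotients of \<open>u\<close> converge to \<open>w\<close> at every point.\<close>
lemma strong_solution_is_classical:
  assumes T: "T > 0" and s: "s > 3/2" and sol: "CH_strong_solution s T u"
  shows "\<exists>M. classical_CH_solution T M u (\<lambda>t. deriv (u t))"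
proof -
  obtain v where cont: "\<And>t. t \<in> {0..T} \<Longrightarrow> continuous_on UNIV (u t)"
    and su: "sobolev_continuous s T u"
    and dv: "sobolev_time_derivative (s - 1) T u v"
    and eq: "\<And>t. t \<in> {0..T} \<Longrightarrow> AE x in lborel. v t x + u t x * deriv (u t) x
               + Defs.convolution (deriv G) (\<lambda>y. (u t y)\<^sup>2 + 1/2 * (deriv (u t) y)\<^sup>2) x = 0"
    using sol unfolding CH_strong_solution_def by blast
  have us: "u t \<in> sobolev s" if "t \<in> {0..T}" for t
    using su that by (simp add: sobolev_continuous_def)
  obtain C0 where C0: "C0 \<ge> 0" "\<And>f h x. f \<in> sobolev s \<Longrightarrow> continuous_on UNIV h \<Longrightarrow> (AE y in lborel. f y = h y) \<Longrightarrow>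
    \<bar>h x\<bar> \<le> C0 * sobolev_norm s f"
    using sobolev_sup_bound[of s] s by auto
  obtain C1 where C1: "C1 \<ge> 0" "\<And>f x. f \<in> sobolev s \<Longrightarrow> continuous_on UNIV f \<Longrightarrow>
      (f has_real_derivative deriv f x) (at x)"
    "\<And>f x. f \<in> sobolev s \<Longrightarrow> continuous_on UNIV f \<Longrightarrow> \<bar>deriv f x\<bar> \<le> C1 * sobolev_norm s f"
    "\<And>f. f \<in> sobolev s \<Longrightarrow> continuous_on UNIV f \<Longrightarrow> continuous_on UNIV (deriv f)"
    using sobolev_deriv_bound[OF s] by blast
  obtain C where C: "C \<ge> 0" "\<And>f h x. f \<in> sobolev (s - 1) \<Longrightarrow> continuous_on UNIV h \<Longrightarrow> (AE y in lborel. f y = h y) \<Longrightarrow>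
    \<bar>h x\<bar> \<le> C * sobolev_norm (s - 1) f"
    using sobolev_sup_bound[of "s - 1"] s by auto
  have du: "(u t has_real_derivative deriv (u t) x) (at x)" if "t \<in> {0..T}" for t x
    by (rule C1(2)[OF us[OF that] cont[OF that]])
  have ucont: "continuous_on UNIV (deriv (u t))" if "t \<in> {0..T}" for t
    by (rule C1(4)[OF us[OF that] cont[OF that]])
  have near: "\<exists>d>0. \<forall>\<tau>\<in>{0..T}. \<bar>\<tau> - t\<bar> < d \<longrightarrow>
        (\<forall>x. \<bar>u \<tau> x - u t x\<bar> \<le> e \<and> \<bar>deriv (u \<tau>) x - deriv (u t) x\<bar> \<le> e)" if t: "t \<in> {0..T}" and e: "e > 0" for t e
  proof -
    define N where "N \<tau> = sobolev_norm s (\<lambda>x. u \<tau> x - u t x)" for \<tau>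
    have "(N \<longlongrightarrow> 0) (at t within {0..T})"
      using su t by (simp add: sobolev_continuous_def N_def[abs_def])
    then have "((\<lambda>\<tau>. (C0 + C1) * N \<tau>) \<longlongrightarrow> 0) (at t within {0..T})" by (rule tendsto_mult_right_zero)
    from order_tendstoD(2)[OF this e] obtain d where d: "d > 0"
      "\<And>\<tau>. \<tau> \<in> {0..T} \<Longrightarrow> \<tau> \<noteq> t \<Longrightarrow> dist \<tau> t < d \<Longrightarrow> (C0 + C1) * N \<tau> < e"
      unfolding eventually_at by blast
    have "\<bar>u \<tau> x - u t x\<bar> \<le> e \<and> \<bar>deriv (u \<tau>) x - deriv (u t) x\<bar> \<le> e"
      if \<tau>: "\<tau> \<in> {0..T}" "\<bar>\<tau> - t\<bar> < d" for \<tau> x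
    proof (cases "\<tau> = t")
      case False
      have le: "(C0 + C1) * N \<tau> < e" using d(2)[of \<tau>] \<tau> False by (simp add: dist_real_def)
      have fs: "(\<lambda>x. u \<tau> x - u t x) \<in> sobolev s"
        using sobolev_lincomb[OF us[OF \<tau>(1)] us[OF t], of "-1"] by simp
      have fc: "continuous_on UNIV (\<lambda>x. u \<tau> x - u t x)"
        by (intro continuous_on_diff cont t \<tau>)
      have b0: "\<bar>u \<tau> x - u t x\<bar> \<le> C0 * N \<tau>"
        unfolding N_def by (rule C0(2)[OF fs fc]) simp
      have "\<bar>deriv (\<lambda>x. u \<tau> x - u t x) x\<bar> \<le> C1 * N \<tau>"
        unfolding N_def by (rule C1(3)[OF fs fc])
      moreover have "deriv (\<lambda>x. u \<tau> x - u t x) x = deriv (u \<tau>) x - deriv (u t) x"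
        by (intro DERIV_imp_deriv DERIV_diff du t \<tau>)
      ultimately have b1: "\<bar>deriv (u \<tau>) x - deriv (u t) x\<bar> \<le> C1 * N \<tau>" by simp
      have "C0 * N \<tau> \<ge> 0" "C1 * N \<tau> \<ge> 0" using b0 b1 by (meson abs_ge_zero order_trans)+
      then show ?thesis using b0 b1 le by (simp add: distrib_right)
    qed (use e in simp)
    then show ?thesis using d(1) by blast
  qed
  have near1: "\<exists>d>0. \<forall>\<tau>\<in>{0..T}. \<bar>\<tau> - t\<bar> < d \<longrightarrow> (\<forall>x. \<bar>u \<tau> x - u t x\<bar> \<le> 1)"
    and near2: "\<exists>d>0. \<forall>\<tau>\<in>{0..T}. \<bar>\<tau> - t\<bar> < d \<longrightarrow> (\<forall>x. \<bar>deriv (u \<tau>) x - deriv (u t) x\<bar> \<le> 1)"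
    if "t \<in> {0..T}" for t
    using near[OF that zero_less_one] by blast+
  have "\<exists>B. \<forall>t\<in>{0..T}. \<forall>x. \<bar>u t x\<bar> \<le> B"
  proof (rule uniform_bound_on_interval[OF _ near1])
    fix t assume t: "t \<in> {0..T}"
    show "\<exists>B. \<forall>x. \<bar>u t x\<bar> \<le> B"
      using C0(2)[OF us[OF t] cont[OF t]] by (intro exI[of _ "C0 * sobolev_norm s (u t)"]) auto
  qed (use T in auto)
  moreover have "\<exists>B. \<forall>t\<in>{0..T}. \<forall>x. \<bar>deriv (u t) x\<bar> \<le> B"
  proof (rule uniform_bound_on_interval[where f = "\<lambda>t. deriv (u t)", OF _ near2])
    fix t assume t: "t \<in> {0..T}"
    show "\<exists>B. \<forall>x. \<bar>deriv (u t) x\<bar> \<le> B"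
      using C1(3)[OF us[OF t] cont[OF t]] by (intro exI[of _ "C1 * sobolev_norm s (u t)"]) auto
  qed (use T in auto)
  ultimately obtain B B' where B: "\<And>t x. t \<in> {0..T} \<Longrightarrow> \<bar>u t x\<bar> \<le> B" "\<And>t x. t \<in> {0..T} \<Longrightarrow> \<bar>deriv (u t) x\<bar> \<le> B'"
    by blast
  define M where "M = max B B'"
  have M: "\<bar>u t x\<bar> \<le> M" "\<bar>deriv (u t) x\<bar> \<le> M" if "t \<in> {0..T}" for t x
    using B(1)[OF that, of x] B(2)[OF that, of x] by (auto simp: M_def)
  have evolution: "((\<lambda>\<tau>. u \<tau> x) has_real_derivative
        - (u t x * deriv (u t) x) - (right_tail (\<lambda>y. (u t y)\<^sup>2 + 1/2 * (deriv (u t) y)\<^sup>2) x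
          - left_tail (\<lambda>y. (u t y)\<^sup>2 + 1/2 * (deriv (u t) y)\<^sup>2) x) / 2) (at t within {0..T})"
    if t: "t \<in> {0..T}" for t x
  proof -
    define F where "F y = (u t y)\<^sup>2 + 1/2 * (deriv (u t) y)\<^sup>2" for y
    have Fc: "continuous_on UNIV F"
      unfolding F_def by (intro continuous_intros cont ucont t)
    have Fb: "\<bar>F y\<bar> \<le> M\<^sup>2 + 1/2 * M\<^sup>2" for y
    proof -
      have "(u t y)\<^sup>2 \<le> M\<^sup>2" "(deriv (u t) y)\<^sup>2 \<le> M\<^sup>2"
        using M[OF t, of y] by (auto intro: power2_le_iff_abs_le[THEN iffD2, rotated] order_trans[OF abs_ge_zero])
      then show ?thesis by (simp add: F_def)
    qed
    define w where "w x = - (u t x * deriv (u t) x) - (right_tail F x - left_tail F x) / 2" for x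
    have "continuous_on UNIV (right_tail F)" "continuous_on UNIV (left_tail F)"
      by (rule DERIV_continuous_on[OF has_field_derivative_at_within[OF right_tail_derivative[OF Fc Fb]]]
        DERIV_continuous_on[OF has_field_derivative_at_within[OF left_tail_derivative[OF Fc Fb]]])+
    then have wc: "continuous_on UNIV w"
      unfolding w_def by (intro continuous_intros cont ucont t) auto
    have vw: "AE x in lborel. v t x = w x"
      using eq[OF t] unfolding F_def[symmetric]
      by eventually_elim
        (simp add: convolution_deriv_G[OF borel_measurable_continuous_onI[OF Fc] Fb] w_def)
    define N where "N \<tau> = sobolev_norm (s - 1) (\<lambda>x. (u \<tau> x - u t x) / (\<tau> - t) - v t x)" for \<tau>
    have N: "(N \<longlongrightarrow> 0) (at t within {0..T})"
      using dv t by (simp add: sobolev_time_derivative_def N_def[abs_def])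
    have quot: "\<bar>(u \<tau> x - u t x) / (\<tau> - t) - w x\<bar> \<le> C * N \<tau>" if \<tau>: "\<tau> \<in> {0..T}" "\<tau> \<noteq> t" for \<tau>
      unfolding N_def
    proof (rule C(2)[where h = "\<lambda>x. (u \<tau> x - u t x) / (\<tau> - t) - w x"])
      have mem: "u \<tau> \<in> sobolev (s - 1)" "u t \<in> sobolev (s - 1)" "v t \<in> sobolev (s - 1)"
        using dv t \<tau> by (auto simp: sobolev_time_derivative_def)
      have "(\<lambda>x. u \<tau> x + - 1 * u t x) \<in> sobolev (s - 1)" by (intro sobolev_lincomb mem)
      from sobolev_lincomb[OF mem(3) this, of "- 1 / (\<tau> - t)"]
      have m: "(\<lambda>x. v t x + - 1 / (\<tau> - t) * (u \<tau> x + - 1 * u t x)) \<in> sobolev (s - 1)" .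
      \<comment> \<open>This is the required function with the opposite sign; \<open>1 - 2 = -1\<close> reverses it.\<close>
      from sobolev_lincomb[OF m m, of "-2"]
      show "(\<lambda>x. (u \<tau> x - u t x) / (\<tau> - t) - v t x) \<in> sobolev (s - 1)"
        by (simp add: diff_divide_distrib algebra_simps)
      show "continuous_on UNIV (\<lambda>x. (u \<tau> x - u t x) / (\<tau> - t) - w x)"
        using \<tau>(2) by (intro continuous_intros cont t \<tau> wc) auto
      show "AE y in lborel. (u \<tau> y - u t y) / (\<tau> - t) - v t y = (u \<tau> y - u t y) / (\<tau> - t) - w y"
        using vw by eventually_elim simp
    qed
    have "((\<lambda>\<tau>. (u \<tau> x - u t x) / (\<tau> - t) - w x) \<longlongrightarrow> 0) (at t within {0..T})"
    proof (rule Lim_null_comparison)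
      show "\<forall>\<^sub>F \<tau> in at t within {0..T}. norm ((u \<tau> x - u t x) / (\<tau> - t) - w x) \<le> C * N \<tau>"
        using quot by (auto simp: eventually_at_filter)
      show "((\<lambda>\<tau>. C * N \<tau>) \<longlongrightarrow> 0) (at t within {0..T})"
        using N by (rule tendsto_mult_right_zero)
    qed
    then have "((\<lambda>\<tau>. u \<tau> x) has_real_derivative w x) (at t within {0..T})"
      unfolding has_field_derivative_iff by (rule Lim_null[THEN iffD2])
    then show ?thesis by (simp add: w_def F_def[abs_def])
  qed
  have "classical_CH_solution T M u (\<lambda>t. deriv (u t))"
    by unfold_locales (use T du ucont M evolution near in auto)
  then show ?thesis by blast
qed

text \<open>Decay at infinity, which concerns large \<open>x\<close> only, holds on the whole line after enlarging the constant,
  as the exponential is bounded below on the left.\<close>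
lemma global_exponential_bound:
  fixes f :: "real \<Rightarrow> real"
  assumes bnd: "\<And>x. \<bar>f x\<bar> \<le> M" and \<alpha>: "\<alpha> > 0"
    and c: "c \<ge> 0" and ev: "eventually (\<lambda>x. \<bar>f x\<bar> \<le> c * exp (- (\<alpha> * x))) at_top"
  obtains A where "A \<ge> 0" "\<And>x. \<bar>f x\<bar> \<le> A * exp (- (\<alpha> * x))"
proof -
  obtain R where R: "\<And>x. x \<ge> R \<Longrightarrow> \<bar>f x\<bar> \<le> c * exp (- (\<alpha> * x))"
    using ev by (auto simp: eventually_at_top_linorder)
  have M: "M \<ge> 0" using bnd[of 0] by (meson abs_ge_zero order_trans)
  show ?thesis
  proof (rule that[of "c + M * exp (\<alpha> * R)"])
    show "c + M * exp (\<alpha> * R) \<ge> 0" using c M by simp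
    fix x
    show "\<bar>f x\<bar> \<le> (c + M * exp (\<alpha> * R)) * exp (- (\<alpha> * x))"
    proof (cases "x \<ge> R")
      case True
      have "0 \<le> M * exp (\<alpha> * R) * exp (- (\<alpha> * x))" using M by simp
      then show ?thesis using R[OF True] by (simp add: distrib_right)
    next
      case False
      then have "\<alpha> * x \<le> \<alpha> * R" using \<alpha> by simp
      then have "1 \<le> exp (\<alpha> * R) * exp (- (\<alpha> * x))" by (simp add: exp_add[symmetric])
      then have "M * 1 \<le> M * (exp (\<alpha> * R) * exp (- (\<alpha> * x)))" using M by (intro mult_left_mono)
      moreover have "0 \<le> c * exp (- (\<alpha> * x))" using c by simp
      ultimately show ?thesis using bnd[of x] by (simp add: distrib_right mult.assoc)
    qed
  qed
qed

section \<open>Unique continuation from decay at two times\<close>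

theorem theorem1p1:
  fixes T s \<alpha> t\<^sub>1 :: real and u :: "real \<Rightarrow> real \<Rightarrow> real"
  assumes "T > 0" and "s > 3/2"
    and "CH_strong_solution s T u"
    and "\<alpha> \<in> {1/2<..<1}"
    and "(\<lambda>x. \<bar>u 0 x\<bar>) \<in> o[at_top](\<lambda>x. exp (- x))"
    and "(\<lambda>x. \<bar>deriv (u 0) x\<bar>) \<in> O[at_top](\<lambda>x. exp (- \<alpha> * x))"
    and "t\<^sub>1 \<in> {0<..T}"
    and "(\<lambda>x. \<bar>u t\<^sub>1 x\<bar>) \<in> o[at_top](\<lambda>x. exp (- x))"
  shows "\<forall>t\<in>{0..T}. \<forall>x. u t x = 0"
proof (intro ballI allI)
  fix t x :: real
  assume t: "t \<in> {0..T}"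
  obtain M where "classical_CH_solution T M u (\<lambda>t. deriv (u t))"
    using strong_solution_is_classical[OF assms(1-3)] by blast
  then interpret classical_CH_solution T M u "\<lambda>t. deriv (u t)" .
  have \<alpha>: "1/2 < \<alpha>" "\<alpha> < 1" using assms(4) by auto
  have 0: "0 \<in> {0..T}" using assms(1) by auto
  have small0: "eventually (\<lambda>x. \<bar>u 0 x\<bar> \<le> e * exp (- x)) at_top" if "e > 0" for e
    using landau_o.smallD[OF assms(5) that] by simp
  have small1: "eventually (\<lambda>x. \<bar>u t\<^sub>1 x\<bar> \<le> e * exp (- x)) at_top" if "e > 0" for e
    using landau_o.smallD[OF assms(8) that] by simp
  have ev: "eventually (\<lambda>x. \<bar>u 0 x\<bar> \<le> 1 * exp (- (\<alpha> * x))) at_top"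
    using small0[OF zero_less_one] eventually_ge_at_top[of 0]
  proof eventually_elim
    case (elim x)
    have "\<alpha> * x \<le> 1 * x" using \<alpha> elim(2) by (intro mult_right_mono) auto
    then have "exp (- x) \<le> exp (- (\<alpha> * x))" by simp
    with elim(1) show ?case by linarith
  qed
  have \<alpha>0: "\<alpha> > 0" using \<alpha> by simp
  obtain A where A: "A \<ge> 0" "\<And>x. \<bar>u 0 x\<bar> \<le> A * exp (- (\<alpha> * x))"
    using global_exponential_bound[where f = "u 0", OF u_le[OF 0] \<alpha>0 zero_le_one ev] by blast
  obtain c where c: "c > 0"
    and "eventually (\<lambda>x. norm \<bar>deriv (u 0) x\<bar> \<le> c * norm (exp (- \<alpha> * x))) at_top"
    using landau_o.bigE[OF assms(6)] by blast
  then have ev': "eventually (\<lambda>x. \<bar>deriv (u 0) x\<bar> \<le> c * exp (- (\<alpha> * x))) at_top" by simp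
  obtain A' where A': "A' \<ge> 0" "\<And>x. \<bar>deriv (u 0) x\<bar> \<le> A' * exp (- (\<alpha> * x))"
    using global_exponential_bound[where f = "deriv (u 0)", OF ux_le[OF 0] \<alpha>0 less_imp_le[OF c] ev'] by blast
  have "A * exp (- (\<alpha> * x)) \<le> max A A' * exp (- (\<alpha> * x))" "A' * exp (- (\<alpha> * x)) \<le> max A A' * exp (- (\<alpha> * x))" for x
    by (intro mult_right_mono; simp)+
  then have max: "\<bar>u 0 x\<bar> \<le> max A A' * exp (- (\<alpha> * x))" "\<bar>deriv (u 0) x\<bar> \<le> max A A' * exp (- (\<alpha> * x))" for x
    using A(2)[of x] A'(2)[of x] by (auto intro: order_trans)
  show "u t x = 0"
    by (rule decay_at_two_times_implies_zero[OF \<alpha> _ max assms(7) small0 small1 t]) (use A in auto)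
qed

end
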